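(* Let $\vec{G}$ be an oriented graph of order $n$ with $\Delta_{\min}(\vec{G}) = \Delta \geq 1$, and let $k \geq \Delta+1$ be an integer. Then $\mathcal{D}_k(\vec{G})$ is connected and has diameter at most $2\Delta n$.
   Context: An oriented graph is a finite digraph without loops, parallel arcs, or pairs of opposite arcs between the same two vertices; its order is its number of vertices. For a vertex $v$, $d^+(v)$ and $d^-(v)$ denote its out-degree and in-degree, and $\Delta_{\min}(\vec{G})=\max_{v\in V(\vec{G})} \min\{d^+(v),d^-(v)\}$. A $k$-dicolouring of $\vec{G}$ is a function $c:V(\vec{G})\to\{1,\dots,k\}$ such that for each $i$ the set $c^{-1}(i)$ induces a subdigraph with no directed cycle. The $k$-dicolouring graph $\mathcal{D}_k(\vec{G})$ is the undirected graph whose vertices are the $k$-dicolourings of $\vec{G}$ and in which two $k$-dicolourings are adjacent if they differ on the colour of exactly one vertex. *)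

theory Defs
  imports "Graph_Theory.Graph_Theory" "HOL-Library.FuncSet"
begin

locale oriented_graph = digraph +
  assumes no_opposite_arcs: "u \<rightarrow> v \<Longrightarrow> \<not> v \<rightarrow> u"

(* The value is unspecified for the graph without vertices. *)
definition Delta_min :: "('a, 'b) pre_digraph \<Rightarrow> nat" where
  "Delta_min G = (MAX v\<in>verts G. min (out_degree G v) (in_degree G v))"

(* Colourings are extensional functions, so that two colourings which agree on the
   vertices of G are equal. *)
definition is_dicolouring :: "('a, 'b) pre_digraph \<Rightarrow> nat \<Rightarrow> ('a \<Rightarrow> nat) \<Rightarrow> bool" where
  "is_dicolouring G k c \<longleftrightarrow> c \<in> verts G \<rightarrow>\<^sub>E {1..k} \<and>
     (\<forall>i\<in>{1..k}. \<not> (\<exists>p. pre_digraph.cycle (G \<restriction> {v \<in> verts G. c v = i}) p))"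

definition dicolouring_graph ::
  "('a, 'b) pre_digraph \<Rightarrow> nat \<Rightarrow> ('a \<Rightarrow> nat, ('a \<Rightarrow> nat) \<times> ('a \<Rightarrow> nat)) pre_digraph" where
  "dicolouring_graph G k =
     \<lparr> verts = {c. is_dicolouring G k c},
       arcs = {(c, d). is_dicolouring G k c \<and> is_dicolouring G k d \<and>
                       (\<exists>!v. v \<in> verts G \<and> c v \<noteq> d v)},
       tail = fst, head = snd \<rparr>"

(* The locale graph consists of the finite symmetric digraphs without loops or parallel
   arcs, i.e. of the finite simple undirected graphs. *)
lemma (in fin_digraph) graph_dicolouring_graph: "graph (dicolouring_graph G k)"
proof -
  have fin: "finite {c. is_dicolouring G k c}"
    by (rule finite_subset[of _ "verts G \<rightarrow>\<^sub>E {1..k}"])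
      (auto simp: is_dicolouring_def intro!: finite_PiE)
  have "finite (arcs (dicolouring_graph G k))"
    by (rule finite_subset[OF _ finite_cartesian_product[OF fin fin]])
      (auto simp: dicolouring_graph_def)
  with fin show ?thesis
    by unfold_locales
      (auto simp: dicolouring_graph_def arc_to_ends_def symmetric_conv eq_commute)
qed

(* With unit weights, \<mu> is the usual distance, with value \<infinity> if there is no walk.
   The constant \<mu> is specified for well-formed digraphs only. *)
definition graph_diameter :: "('a, 'b) pre_digraph \<Rightarrow> ereal" where
  "graph_diameter G = (SUP u\<in>verts G. SUP v\<in>verts G. wf_digraph.\<mu> G (\<lambda>_. 1) u v)"

end

theory Submission
  imports Defs
begin

text \<open>
  The arcs of the oriented graph are treated as an asymmetric relation \<open>r\<close> on a finite vertex set
  \<open>V\<close>, and the palette is an arbitrary finite set of colours, so that passing to a subgraph with fewer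
  colours needs no renaming. Write \<open>n\<close> for the number of vertices and \<open>d\<close> for the bound on
  \<open>\<Delta>\<^sub>m\<^sub>i\<^sub>n\<close>. Every reduction rests on one observation: if \<open>J\<close> is a maximal acyclic
  vertex set, then each vertex outside \<open>J\<close> has an in-neighbour and an out-neighbour in \<open>J\<close>, so deleting
  \<open>J\<close> lowers \<open>d\<close> by one (\<open>min_degree_le_Diff_maximal\<close>).

  The bound \<open>2dn\<close> follows by induction on \<open>d\<close> (\<open>recolours_bound\<close>). To go from \<open>\<phi>\<close> to \<open>\<psi>\<close>, first
  make some colour \<open>c\<close> disappear from \<open>\<phi>\<close> in at most \<open>2n\<close> steps (\<open>recolours_free_colour\<close>). Extend the class
  of \<open>c\<close> in \<open>\<psi>\<close> to a maximal acyclic set \<open>J\<close>, paint \<open>J\<close> with the now unused colour \<open>c\<close>, solve the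
  problem on \<open>V - J\<close> with the remaining colours by induction, and repaint \<open>J\<close> as in \<open>\<psi>\<close>. The total is at
  most \<open>2n + 2|J| + 2(d - 1)(n - |J|) \<le> 2dn\<close> when \<open>d \<ge> 2\<close>.

  The case \<open>d = 1\<close> (\<open>recolours_min_degree_1\<close>) reduces to two colours \<open>p\<close> and \<open>q\<close>. There the colouring that
  gives \<open>q\<close> to a maximal acyclic set and \<open>p\<close> to the rest is a universal target: every
  2-dicolouring reaches it with each vertex recoloured at most once, because some vertex with the wrong colour can always
  be corrected at once (\<open>not_frozen\<close>). So two 2-dicolourings are at distance at most \<open>2n\<close>.

  Freeing a colour reduces, by deleting maximal acyclic sets, to \<open>d = 2\<close>, where the point is that an oriented graph
  with \<open>\<Delta>\<^sub>m\<^sub>i\<^sub>n \<le> 2\<close> is 2-dicolourable (\<open>two_colourable_min_degree_2\<close>). For this, let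
  the parents of a vertex be its in-neighbours if there are at most two of them and its out-neighbours otherwise. The parent relation \<open>P\<close> has in-degree at most 2, and its pairs of opposite arcs
  join a vertex of the first kind to one of the second kind, so that they form a bipartite graph. It then suffices to
  prove a directed Brooks theorem: a digraph with in-degrees at most 2 whose digons form a bipartite graph is 2-dicolourable
  (\<open>two_colourable_in_degree_2\<close>). In a vertex-critical counterexample all in- and out-degrees are 2, and if all vertices
  but \<open>r\<close> are coloured, the two in-neighbours of \<open>r\<close> have different colours, and so have its two out-neighbours. Hence
  the uncoloured place, the token, can be moved to any neighbour \<open>x\<close> by giving \<open>r\<close> the colour of \<open>x\<close>. Moving the
  token around a cycle of the underlying graph rotates the colours on the cycle. This restricts the possible cycles so much
  that every vertex lies on two digons, and then the bipartition of the digons is itself a 2-dicolouring.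
\<close>

section \<open>Acyclic vertex sets and degrees\<close>

definition acyclic_on :: "'a rel \<Rightarrow> 'a set \<Rightarrow> bool" where
  "acyclic_on r S \<longleftrightarrow> acyclic (Restr r S)"

definition in_nbrs :: "'a rel \<Rightarrow> 'a set \<Rightarrow> 'a \<Rightarrow> 'a set" where
  "in_nbrs r V v = {u \<in> V. (u, v) \<in> r}"

definition out_nbrs :: "'a rel \<Rightarrow> 'a set \<Rightarrow> 'a \<Rightarrow> 'a set" where
  "out_nbrs r V v = {u \<in> V. (v, u) \<in> r}"

definition min_degree_le :: "'a rel \<Rightarrow> 'a set \<Rightarrow> nat \<Rightarrow> bool" where
  "min_degree_le r V d \<longleftrightarrow>
     (\<forall>v\<in>V. card (in_nbrs r V v) \<le> d \<or> card (out_nbrs r V v) \<le> d)"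

lemma in_nbrs_converse [simp]: "in_nbrs (r\<inverse>) V v = out_nbrs r V v"
  by (simp add: in_nbrs_def out_nbrs_def)

lemma out_nbrs_converse [simp]: "out_nbrs (r\<inverse>) V v = in_nbrs r V v"
  by (simp add: in_nbrs_def out_nbrs_def)

lemma min_degree_le_converse [simp]: "min_degree_le (r\<inverse>) V d \<longleftrightarrow> min_degree_le r V d"
  by (auto simp: min_degree_le_def)

lemma finite_nbrs [simp, intro]:
  assumes "finite V"
  shows "finite (in_nbrs r V v)" "finite (out_nbrs r V v)"
  using assms by (auto simp: in_nbrs_def out_nbrs_def)

lemma min_degree_le_subset:
  assumes "min_degree_le r V d" "W \<subseteq> V" "finite V"
  shows "min_degree_le r W d"
  unfolding min_degree_le_def
proof
  fix v assume v: "v \<in> W"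
  have "in_nbrs r W v \<subseteq> in_nbrs r V v" "out_nbrs r W v \<subseteq> out_nbrs r V v"
    using assms by (auto simp: in_nbrs_def out_nbrs_def)
  then have "card (in_nbrs r W v) \<le> card (in_nbrs r V v)"
    "card (out_nbrs r W v) \<le> card (out_nbrs r V v)"
    using assms by (auto intro!: card_mono)
  with assms v show "card (in_nbrs r W v) \<le> d \<or> card (out_nbrs r W v) \<le> d"
    unfolding min_degree_le_def by (meson le_trans subsetD)
qed

lemma acyclic_on_converse [simp]: "acyclic_on (r\<inverse>) S \<longleftrightarrow> acyclic_on r S"
proof -
  have "Restr (r\<inverse>) S = (Restr r S)\<inverse>" by auto
  then show ?thesis by (simp add: acyclic_on_def)
qed

lemma acyclic_on_mono: "acyclic_on r T \<Longrightarrow> S \<subseteq> T \<Longrightarrow> acyclic_on r S"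
  unfolding acyclic_on_def by (erule acyclic_subset) auto

lemma acyclic_on_empty [simp]: "acyclic_on r {}"
  by (simp add: acyclic_on_def acyclic_def)

lemma trancl_first_step:
  assumes "(v, y) \<in> (Restr r (insert v J))\<^sup>+" "y \<noteq> v"
  shows "\<exists>p. p \<in> J \<and> (v, p) \<in> r \<and> (p, y) \<in> (Restr r J)\<^sup>*"
  using assms
proof (induction rule: trancl_induct)
  case (base y)
  then show ?case by auto
next
  case (step y z)
  show ?case
  proof (cases "y = v")
    case True
    with step show ?thesis by auto
  next
    case False
    with step obtain p where p: "p \<in> J" "(v, p) \<in> r" "(p, y) \<in> (Restr r J)\<^sup>*" by auto
    moreover have "(y, z) \<in> Restr r J" using step False by auto
    ultimately show ?thesis by (meson rtrancl.rtrancl_into_rtrancl)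
  qed
qed

lemma trancl_avoid_or_visit:
  assumes "(x, y) \<in> (Restr r (insert v J))\<^sup>+"
  shows "(x, y) \<in> (Restr r J)\<^sup>+ \<or>
    (x, v) \<in> (Restr r (insert v J))\<^sup>* \<and> (v, y) \<in> (Restr r (insert v J))\<^sup>*"
  using assms
proof (induction rule: trancl_induct)
  case (base y)
  then show ?case by (cases "x = v \<or> y = v") auto
next
  case (step y z)
  show ?case
  proof (cases "(x, y) \<in> (Restr r J)\<^sup>+")
    case True
    then have "y \<in> J" by (metis IntE SigmaE2 tranclE)
    show ?thesis
    proof (cases "z = v")
      case True
      then show ?thesis
        using step.hyps by (metis rtrancl.rtrancl_refl trancl_into_rtrancl trancl.trancl_into_trancl)
    next
      case False
      then have "(y, z) \<in> Restr r J" using step.hyps \<open>y \<in> J\<close> by auto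
      then show ?thesis using True by (meson trancl.trancl_into_trancl)
    qed
  next
    case False
    then show ?thesis using step by (meson rtrancl.rtrancl_into_rtrancl)
  qed
qed

text \<open>
  All obstructions to recolouring a vertex \<open>v\<close> are used in this form: a path inside the new colour class which \<open>v\<close>
  closes to a cycle. The path is kept apart from \<open>v\<close>, so that its inner arcs stay inside \<open>J\<close>.
\<close>

lemma new_cycle_path:
  assumes J: "acyclic_on r J" and closes: "\<not> acyclic_on r (insert v J)" and irr: "(v, v) \<notin> r"
  obtains p q where "p \<in> J" "q \<in> J" "(v, p) \<in> r" "(q, v) \<in> r" "(p, q) \<in> (Restr r J)\<^sup>*"
proof -
  let ?S = "Restr r (insert v J)"
  obtain x where x: "(x, x) \<in> ?S\<^sup>+" using closes by (auto simp: acyclic_on_def acyclic_def)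
  have "(x, x) \<notin> (Restr r J)\<^sup>+" using J by (auto simp: acyclic_on_def acyclic_def)
  then have "(x, v) \<in> ?S\<^sup>*" "(v, x) \<in> ?S\<^sup>*" using trancl_avoid_or_visit[OF x] by auto
  then have "(v, v) \<in> ?S\<^sup>+" using x by (meson rtrancl_trancl_trancl trancl_rtrancl_trancl)
  then obtain q where q: "(v, q) \<in> ?S\<^sup>*" "(q, v) \<in> ?S" by (meson tranclD2)
  have "q \<noteq> v" using q irr by auto
  then have "(v, q) \<in> ?S\<^sup>+" using q by (auto dest: rtranclD)
  from trancl_first_step[OF this \<open>q \<noteq> v\<close>] obtain p
    where "p \<in> J" "(v, p) \<in> r" "(p, q) \<in> (Restr r J)\<^sup>*" by auto
  moreover have "q \<in> J" "(q, v) \<in> r" using q \<open>q \<noteq> v\<close> by auto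
  ultimately show thesis using that by blast
qed

lemma acyclic_on_insert:
  assumes "acyclic_on r J" "(v, v) \<notin> r" "in_nbrs r J v = {} \<or> out_nbrs r J v = {}"
  shows "acyclic_on r (insert v J)"
proof (rule ccontr)
  assume "\<not> acyclic_on r (insert v J)"
  from new_cycle_path[OF assms(1) this assms(2)] show False
    using assms(3) by (auto simp: in_nbrs_def out_nbrs_def)
qed

lemma acyclic_on_Un:
  assumes "finite X" "acyclic_on r S" "\<And>v. v \<in> X \<Longrightarrow> (v, v) \<notin> r"
    "\<And>v. v \<in> X \<Longrightarrow> in_nbrs r (S \<union> X) v = {} \<or> out_nbrs r (S \<union> X) v = {}"
  shows "acyclic_on r (S \<union> X)"
proof -
  have "acyclic_on r (S \<union> Y)" if "finite Y" "Y \<subseteq> X" for Y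
    using that
  proof (induction Y rule: finite_induct)
    case empty
    then show ?case using assms by simp
  next
    case (insert v Y)
    have "in_nbrs r (S \<union> Y) v \<subseteq> in_nbrs r (S \<union> X) v"
      "out_nbrs r (S \<union> Y) v \<subseteq> out_nbrs r (S \<union> X) v"
      using insert.prems by (auto simp: in_nbrs_def out_nbrs_def)
    then have "acyclic_on r (insert v (S \<union> Y))"
      using insert assms(3,4)[of v] by (intro acyclic_on_insert) auto
    then show ?case by simp
  qed
  then show ?thesis using assms by blast
qed

lemma maximal_acyclic_extension:
  assumes "finite V" "S \<subseteq> V" "acyclic_on r S"
  obtains J where "S \<subseteq> J" "J \<subseteq> V" "acyclic_on r J"
    "\<And>v. v \<in> V - J \<Longrightarrow> \<not> acyclic_on r (insert v J)"
proof -
  let ?F = "{J. S \<subseteq> J \<and> J \<subseteq> V \<and> acyclic_on r J}"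
  have "finite ?F" using assms by (auto intro: finite_subset[of _ "Pow V"])
  moreover have "?F \<noteq> {}" using assms by auto
  ultimately obtain J where J: "J \<in> ?F" "\<And>J'. J' \<in> ?F \<Longrightarrow> J \<subseteq> J' \<Longrightarrow> J = J'"
    by (meson finite_has_maximal)
  show thesis
  proof
    fix v assume v: "v \<in> V - J"
    show "\<not> acyclic_on r (insert v J)"
    proof
      assume "acyclic_on r (insert v J)"
      then have "J = insert v J" using J v by (intro J(2)) auto
      with v show False by auto
    qed
  qed (use J in auto)
qed

lemma nbrs_in_maximal:
  assumes "acyclic_on r J" "\<not> acyclic_on r (insert v J)" "(v, v) \<notin> r"
  shows "in_nbrs r J v \<noteq> {}" "out_nbrs r J v \<noteq> {}"
  using new_cycle_path[OF assms] by (auto simp: in_nbrs_def out_nbrs_def)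

text \<open>
  Each remaining vertex loses at least one in-neighbour and one out-neighbour, since it closes a cycle with \<open>J\<close>.
\<close>

lemma min_degree_le_Diff_maximal:
  assumes "finite V" "asym r" "min_degree_le r V (Suc d)" "J \<subseteq> V" "acyclic_on r J"
    and maxJ: "\<And>v. v \<in> V - J \<Longrightarrow> \<not> acyclic_on r (insert v J)"
  shows "min_degree_le r (V - J) d"
  unfolding min_degree_le_def
proof
  fix v assume v: "v \<in> V - J"
  have "(v, v) \<notin> r" using assms(2) by (auto dest: asymD)
  note ne = nbrs_in_maximal[OF assms(5) maxJ[OF v] this]
  have "in_nbrs r (V - J) v \<subset> in_nbrs r V v" "out_nbrs r (V - J) v \<subset> out_nbrs r V v"
    using ne assms(4) by (auto simp: in_nbrs_def out_nbrs_def)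
  then have "card (in_nbrs r (V - J) v) < card (in_nbrs r V v)"
    "card (out_nbrs r (V - J) v) < card (out_nbrs r V v)"
    using assms(1) by (auto intro!: psubset_card_mono)
  then show "card (in_nbrs r (V - J) v) \<le> d \<or> card (out_nbrs r (V - J) v) \<le> d"
    using assms(3) v unfolding min_degree_le_def by force
qed

lemma acyclic_on_min_degree_0:
  assumes "finite V" "asym r" "min_degree_le r V 0"
  shows "acyclic_on r V"
proof -
  have "acyclic_on r ({} \<union> V)"
    using assms by (intro acyclic_on_Un) (auto simp: min_degree_le_def dest: asymD)
  then show ?thesis by simp
qed

section \<open>Colourings and recolouring sequences\<close>

definition dicolours :: "'a rel \<Rightarrow> 'a set \<Rightarrow> nat set \<Rightarrow> ('a \<Rightarrow> nat) \<Rightarrow> bool" where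
  "dicolours r V K \<phi> \<longleftrightarrow> (\<forall>v\<in>V. \<phi> v \<in> K) \<and> (\<forall>i. acyclic_on r {v \<in> V. \<phi> v = i})"

text \<open>
  The number \<open>n\<close> is an upper bound for the number of steps, and colourings are compared on \<open>V\<close> only: values outside
  \<open>V\<close> are irrelevant, which allows the same function to serve as a colouring of an induced subgraph.
\<close>

inductive recolours :: "'a rel \<Rightarrow> 'a set \<Rightarrow> nat set \<Rightarrow> nat \<Rightarrow> ('a \<Rightarrow> nat) \<Rightarrow> ('a \<Rightarrow> nat) \<Rightarrow> bool"
  for r V K where
  refl: "dicolours r V K \<phi> \<Longrightarrow> \<forall>u\<in>V. \<phi> u = \<psi> u \<Longrightarrow> recolours r V K n \<phi> \<psi>"
| step: "recolours r V K n \<phi> \<psi> \<Longrightarrow> dicolours r V K \<chi> \<Longrightarrow> \<forall>u\<in>V - {v}. \<psi> u = \<chi> u \<Longrightarrow> recolours r V K (Suc n) \<phi> \<chi>"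

lemma dicolours_cong:
  assumes "\<And>v. v \<in> V \<Longrightarrow> \<phi> v = \<psi> v"
  shows "dicolours r V K \<phi> \<longleftrightarrow> dicolours r V K \<psi>"
proof -
  have "{v \<in> V. \<phi> v = i} = {v \<in> V. \<psi> v = i}" for i using assms by auto
  then show ?thesis using assms by (simp add: dicolours_def)
qed

lemma dicolours_mono: "dicolours r V K \<phi> \<Longrightarrow> K \<subseteq> K' \<Longrightarrow> dicolours r V K' \<phi>"
  by (auto simp: dicolours_def)

lemma dicolours_restrict:
  assumes "dicolours r V K \<phi>" "W \<subseteq> V" "\<And>v. v \<in> W \<Longrightarrow> \<phi> v \<in> K'"
  shows "dicolours r W K' \<phi>"
  unfolding dicolours_def
proof (intro conjI allI)
  show "acyclic_on r {v \<in> W. \<phi> v = i}" for i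
    by (rule acyclic_on_mono[of r "{v \<in> V. \<phi> v = i}"]) (use assms in \<open>auto simp: dicolours_def\<close>)
qed (use assms in auto)

lemma recolours_dicol: "recolours r V K n \<phi> \<psi> \<Longrightarrow> dicolours r V K \<phi> \<and> dicolours r V K \<psi>"
proof (induction rule: recolours.induct)
  case (refl \<phi> \<psi> n)
  then show ?case using dicolours_cong[of V \<phi> \<psi>] by blast
qed blast

lemma recolours_mono: "recolours r V K m \<phi> \<psi> \<Longrightarrow> m \<le> n \<Longrightarrow> recolours r V K n \<phi> \<psi>"
proof (induction arbitrary: n rule: recolours.induct)
  case (refl \<phi> \<psi> n)
  then show ?case by (auto intro: recolours.refl)
next
  case (step m \<phi> \<psi> \<chi> v)
  then obtain n' where "n = Suc n'" "m \<le> n'" by (cases n) auto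
  then show ?case using step recolours.step[of r V K n' \<phi> \<psi> \<chi> v] by simp
qed

lemma recolours_cong_right:
  assumes "recolours r V K n \<phi> \<psi>" "\<And>v. v \<in> V \<Longrightarrow> \<psi> v = \<psi>' v"
  shows "recolours r V K n \<phi> \<psi>'"
  using assms
proof (induction arbitrary: \<psi>' rule: recolours.induct)
  case (refl \<phi> \<psi> n)
  then show ?case by (auto intro: recolours.refl)
next
  case (step n \<phi> \<psi> \<chi> v)
  have "dicolours r V K \<psi>'" using step.hyps(2) dicolours_cong[of V \<chi> \<psi>'] step.prems by blast
  then show ?case using step by (intro recolours.step[OF step.hyps(1), of \<psi>' v]) auto
qed

lemma recolours_trans:
  assumes "recolours r V K n \<psi> \<chi>" "recolours r V K m \<phi> \<psi>"
  shows "recolours r V K (m + n) \<phi> \<chi>"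
  using assms
proof (induction rule: recolours.induct)
  case (refl \<psi> \<chi> n)
  then show ?case using recolours_cong_right[of r V K m \<phi> \<psi> \<chi>] recolours_mono by force
next
  case (step n \<psi> \<chi> \<omega> v)
  then show ?case using recolours.step[of r V K "m + n" \<phi> \<chi> \<omega> v] by simp
qed

lemma recolours_sym:
  assumes "recolours r V K n \<phi> \<psi>"
  shows "recolours r V K n \<psi> \<phi>"
  using assms
proof (induction rule: recolours.induct)
  case (refl \<phi> \<psi> n)
  then show ?case using dicolours_cong[of V \<phi> \<psi>] by (auto intro: recolours.refl)
next
  case (step n \<phi> \<psi> \<chi> v)
  have "recolours r V K 1 \<chi> \<psi>"
    using recolours.step[OF recolours.refl[of r V K \<chi> \<chi> 0], of \<psi> v] step.hyps recolours_dicol[OF step.hyps(1)]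
    by auto
  from recolours_trans[OF step.IH this] show ?case by (simp only: plus_1_eq_Suc)
qed

text \<open>
  A recolouring sequence outside \<open>J\<close> can be performed in the whole graph while the colours on \<open>J\<close> rest, as long as
  the combined colourings are valid.
\<close>

lemma recolours_extend:
  assumes "recolours r (V - J) K n \<phi> \<psi>"
    and ext: "\<And>\<chi>. dicolours r (V - J) K \<chi> \<Longrightarrow> dicolours r V K' (\<lambda>v. if v \<in> J then f v else \<chi> v)"
  shows "recolours r V K' n (\<lambda>v. if v \<in> J then f v else \<phi> v) (\<lambda>v. if v \<in> J then f v else \<psi> v)"
  using assms(1)
proof (induction rule: recolours.induct)
  case (refl \<phi> \<psi> n)
  then show ?case by (auto intro!: recolours.refl ext)
next
  case (step n \<phi> \<psi> \<chi> v)
  then show ?case by (intro recolours.step[OF step.IH, of _ v] ext) auto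
qed

text \<open>
  If every vertexwise mixture of two colourings is valid, then the order in which the vertices are recoloured does not matter.
\<close>

lemma recolours_mix:
  assumes "finite V" "dicolours r V K \<phi>"
    and mix: "\<And>\<chi>. (\<And>v. v \<in> V \<Longrightarrow> \<chi> v = \<phi> v \<or> \<chi> v = \<psi> v) \<Longrightarrow> dicolours r V K \<chi>"
  shows "recolours r V K (card {v \<in> V. \<phi> v \<noteq> \<psi> v}) \<phi> \<psi>"
proof -
  have "recolours r V K (card X) \<phi> (\<lambda>v. if v \<in> X then \<psi> v else \<phi> v)" if "finite X" "X \<subseteq> V" for X
    using that
  proof (induction X rule: finite_induct)
    case empty
    then show ?case using assms by (auto intro: recolours.refl)
  next
    case (insert x X)
    then show ?case
      by (simp, intro recolours.step[where v = x and \<psi> = "\<lambda>v. if v \<in> X then \<psi> v else \<phi> v"] mix) auto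
  qed
  from this[of "{v \<in> V. \<phi> v \<noteq> \<psi> v}"] have
    "recolours r V K (card {v \<in> V. \<phi> v \<noteq> \<psi> v}) \<phi> (\<lambda>v. if v \<in> {v \<in> V. \<phi> v \<noteq> \<psi> v} then \<psi> v else \<phi> v)"
    using assms(1) by auto
  then show ?thesis by (rule recolours_cong_right) auto
qed

section \<open>Two-colouring digraphs of in-degree at most two\<close>

lemma rtrancl_distinct_path:
  assumes "(x, y) \<in> R\<^sup>*"
  shows "\<exists>xs. xs \<noteq> [] \<and> hd xs = x \<and> last xs = y \<and> distinct xs \<and>
    successively (\<lambda>u v. (u, v) \<in> R) xs"
  using assms
proof (induction rule: rtrancl_induct)
  case base
  show ?case by (rule exI[of _ "[x]"]) simp
next
  case (step y z)
  then obtain xs where xs: "xs \<noteq> []" "hd xs = x" "last xs = y" "distinct xs"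
    "successively (\<lambda>u v. (u, v) \<in> R) xs" by blast
  show ?case
  proof (cases "z \<in> set xs")
    case True
    then obtain ys zs where "xs = ys @ z # zs" by (meson split_list)
    with xs show ?thesis
      by (intro exI[of _ "ys @ [z]"]) (auto simp: successively_append_iff hd_append)
  next
    case False
    with xs step show ?thesis
      by (intro exI[of _ "xs @ [z]"]) (auto simp: successively_append_iff)
  qed
qed

lemma successively_Restr_subset:
  assumes "successively (\<lambda>u v. (u, v) \<in> Restr R S) xs" "xs \<noteq> []" "hd xs \<in> S"
  shows "set xs \<subseteq> S"
  using assms by (induction xs rule: induct_list012) auto

lemma acyclic_on_no_return:
  assumes "acyclic_on r (X \<inter> C)" "acyclic_on r (X - C)"
    and closed: "\<And>u v. u \<in> X \<inter> C \<Longrightarrow> v \<in> X - C \<Longrightarrow> (u, v) \<notin> r"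
  shows "acyclic_on r X"
proof -
  have "(x \<in> C \<longrightarrow> y \<in> C \<and> (x, y) \<in> (Restr r (X \<inter> C))\<^sup>+) \<and>
    (y \<notin> C \<longrightarrow> x \<notin> C \<and> (x, y) \<in> (Restr r (X - C))\<^sup>+)"
    if "(x, y) \<in> (Restr r X)\<^sup>+" for x y
    using that
  proof (induction rule: trancl_induct)
    case (base y)
    then show ?case using closed[of x y] by auto
  next
    case (step y z)
    then have yz: "(y, z) \<in> r" "y \<in> X" "z \<in> X" "y \<in> C \<Longrightarrow> z \<in> C" using closed[of y z] by auto
    show ?case
    proof (intro conjI impI)
      assume "x \<in> C"
      with step.IH have y: "y \<in> C" "(x, y) \<in> (Restr r (X \<inter> C))\<^sup>+" by auto
      then show "z \<in> C" "(x, z) \<in> (Restr r (X \<inter> C))\<^sup>+"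
        using yz trancl_into_trancl[OF y(2), of z] by auto
    next
      assume z: "z \<notin> C"
      with yz have "y \<notin> C" by auto
      with step.IH have y: "x \<notin> C" "(x, y) \<in> (Restr r (X - C))\<^sup>+" by auto
      then show "x \<notin> C" "(x, z) \<in> (Restr r (X - C))\<^sup>+"
        using yz z \<open>y \<notin> C\<close> trancl_into_trancl[OF y(2), of z] by auto
    qed
  qed
  then show ?thesis using assms(1,2) unfolding acyclic_on_def acyclic_def by blast
qed

text \<open>
  A cycle of the underlying graph in which every vertex has a single in-neighbour is consistently oriented: the vertex reached
  by a forward arc has already met its in-neighbour, so the next arc leads out of it. Taking \<open>Q\<close> to be a converse relation
  gives the statement for single out-neighbours.
\<close>

lemma directed_propagate:
  assumes "distinct Z" "set Z \<subseteq> V" "successively (\<lambda>u v. (u, v) \<in> Q \<or> (v, u) \<in> Q) Z"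
    and "\<And>t. t \<in> set Z \<Longrightarrow> card (in_nbrs Q V t \<inter> set Z) = 1"
    and "(Z ! 0, Z ! 1) \<in> Q" "Suc i < length Z"
  shows "(Z ! i, Z ! Suc i) \<in> Q"
  using assms(6)
proof (induction i)
  case 0
  then show ?case using assms(5) by simp
next
  case (Suc i)
  let ?t = "Z ! Suc i"
  have IH: "(Z ! i, ?t) \<in> Q" using Suc by simp
  have "(?t, Z ! Suc (Suc i)) \<in> Q \<or> (Z ! Suc (Suc i), ?t) \<in> Q"
    using assms(3) Suc.prems by (auto simp: successively_conv_nth)
  moreover have "(Z ! Suc (Suc i), ?t) \<notin> Q"
  proof
    assume *: "(Z ! Suc (Suc i), ?t) \<in> Q"
    have "card (in_nbrs Q V ?t \<inter> set Z) = 1" using assms(4) Suc.prems by simp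
    then obtain x where x: "in_nbrs Q V ?t \<inter> set Z = {x}" by (auto simp: card_1_singleton_iff)
    have "Z ! i \<in> set Z" "Z ! Suc (Suc i) \<in> set Z" using Suc.prems by auto
    then have "Z ! i \<in> in_nbrs Q V ?t \<inter> set Z" "Z ! Suc (Suc i) \<in> in_nbrs Q V ?t \<inter> set Z"
      using IH * assms(2) by (auto simp: in_nbrs_def)
    then have "Z ! i = Z ! Suc (Suc i)" using x by auto
    then show False using assms(1) Suc.prems by (simp add: nth_eq_iff_index_eq)
  qed
  ultimately show ?case by blast
qed

definition two_dicolours :: "'a rel \<Rightarrow> 'a set \<Rightarrow> ('a \<Rightarrow> bool) \<Rightarrow> bool" where
  "two_dicolours P V \<phi> \<longleftrightarrow> (\<forall>b. acyclic_on P {v \<in> V. \<phi> v = b})"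

text \<open>
  A vertex-critical counterexample to the directed Brooks theorem below. The function \<open>s\<close> is a bipartition of the digons.
\<close>

locale critical =
  fixes P :: "'a rel" and V :: "'a set" and s :: "'a \<Rightarrow> bool"
  assumes fin: "finite V"
    and irr: "(v, v) \<notin> P"
    and in_deg: "v \<in> V \<Longrightarrow> card (in_nbrs P V v) \<le> 2"
    and digon: "u \<in> V \<Longrightarrow> v \<in> V \<Longrightarrow> (u, v) \<in> P \<Longrightarrow> (v, u) \<in> P \<Longrightarrow> s u \<noteq> s v"
    and not_col: "\<not> two_dicolours P V \<phi>"
    and crit: "v \<in> V \<Longrightarrow> \<exists>\<phi>. two_dicolours P (V - {v}) \<phi>"
begin

abbreviation "inn \<equiv> in_nbrs P V"
abbreviation "outn \<equiv> out_nbrs P V"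

definition adj :: "'a \<Rightarrow> 'a \<Rightarrow> bool" where
  "adj u v \<longleftrightarrow> (u, v) \<in> P \<or> (v, u) \<in> P"

lemma adj_sym: "adj u v \<Longrightarrow> adj v u"
  by (auto simp: adj_def)

text \<open>
  Otherwise \<open>r\<close> could be given the colour \<open>b\<close>. So \<open>r\<close> has in- and out-neighbours of both colours, which forces the
  graph to be 2-diregular.
\<close>

lemma blocked:
  assumes "r \<in> V" "two_dicolours P (V - {r}) \<phi>"
  obtains p q where "p \<in> outn r" "q \<in> inn r" "\<phi> p = b" "\<phi> q = b" "p \<noteq> r" "q \<noteq> r"
    "(p, q) \<in> (Restr P {v \<in> V - {r}. \<phi> v = b})\<^sup>*"
proof -
  let ?S = "{v \<in> V - {r}. \<phi> v = b}"
  have S: "acyclic_on P ?S" using assms by (auto simp: two_dicolours_def)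
  have "\<not> acyclic_on P (insert r ?S)"
  proof
    assume *: "acyclic_on P (insert r ?S)"
    have "two_dicolours P V (\<phi>(r := b))"
      unfolding two_dicolours_def
    proof
      fix b'
      show "acyclic_on P {v \<in> V. (\<phi>(r := b)) v = b'}"
      proof (cases "b' = b")
        case True
        show ?thesis by (rule acyclic_on_mono[OF *]) (use True in auto)
      next
        case False
        have "acyclic_on P {v \<in> V - {r}. \<phi> v = b'}" using assms by (auto simp: two_dicolours_def)
        then show ?thesis by (rule acyclic_on_mono) (use False in auto)
      qed
    qed
    then show False using not_col by blast
  qed
  from new_cycle_path[OF S this irr] that show thesis
    unfolding in_nbrs_def out_nbrs_def by blast
qed

lemma finite_inn_outn [simp]: "finite (inn v)" "finite (outn v)"
  using fin by auto

lemma two_le_card: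
  assumes "r \<in> V"
  shows "2 \<le> card (inn r)" "2 \<le> card (outn r)"
proof -
  obtain \<phi> where \<phi>: "two_dicolours P (V - {r}) \<phi>" using crit assms by blast
  obtain p q where 1: "p \<in> outn r" "q \<in> inn r" "\<phi> p = True" "\<phi> q = True"
    using blocked[OF assms \<phi>, of True] by metis
  obtain p' q' where 2: "p' \<in> outn r" "q' \<in> inn r" "\<phi> p' = False" "\<phi> q' = False"
    using blocked[OF assms \<phi>, of False] by metis
  have "card {q, q'} \<le> card (inn r)" "card {p, p'} \<le> card (outn r)"
    using 1 2 by (auto intro!: card_mono)
  moreover have "q \<noteq> q'" "p \<noteq> p'" using 1 2 by auto
  ultimately show "2 \<le> card (inn r)" "2 \<le> card (outn r)" by auto
qed

lemma card_inn: "v \<in> V \<Longrightarrow> card (inn v) = 2"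
  using two_le_card in_deg by (simp add: le_antisym)

lemma card_outn:
  assumes "r \<in> V"
  shows "card (outn r) = 2"
proof (rule ccontr)
  assume "card (outn r) \<noteq> 2"
  then have "card (outn r) > 2" using two_le_card[OF assms] by simp
  then have "(\<Sum>v\<in>V. 2) < (\<Sum>v\<in>V. card (outn v))"
    using fin assms two_le_card by (intro sum_strict_mono_ex1) auto
  also have "\<dots> = card (SIGMA v:V. outn v)" using fin by simp
  also have "(SIGMA v:V. outn v) = prod.swap ` (SIGMA v:V. inn v)"
    by (force simp: in_nbrs_def out_nbrs_def)
  also have "card \<dots> = card (SIGMA v:V. inn v)" by (rule card_image) auto
  also have "\<dots> = (\<Sum>v\<in>V. card (inn v))" using fin by simp
  also have "\<dots> = (\<Sum>v\<in>V. 2)" by (simp add: card_inn)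
  finally show False by simp
qed

lemma nbrs_bichromatic:
  assumes "r \<in> V" "two_dicolours P (V - {r}) \<phi>" "N = inn r \<or> N = outn r" "x \<in> N" "y \<in> N" "x \<noteq> y"
  shows "\<phi> x \<noteq> \<phi> y"
proof -
  obtain p where p: "p \<in> N" "\<phi> p = True" using blocked[OF assms(1,2), of True] assms(3) by metis
  obtain q where q: "q \<in> N" "\<phi> q = False" using blocked[OF assms(1,2), of False] assms(3) by metis
  have "card N = 2" using assms(1,3) card_inn card_outn by auto
  then have "N = {x, y}" using assms(4-6) by (auto simp: card_2_iff)
  with p q show ?thesis by auto
qed

text \<open>
  The only in-neighbour (or out-neighbour) of \<open>r\<close> with the colour of \<open>x\<close> is \<open>x\<close> itself. Once \<open>x\<close> is uncoloured, no
  cycle of that colour can pass through \<open>r\<close>.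
\<close>

lemma shift_token:
  assumes "r \<in> V" "two_dicolours P (V - {r}) \<phi>" "x \<in> V" "adj r x"
  shows "two_dicolours P (V - {x}) (\<phi>(r := \<phi> x))"
  unfolding two_dicolours_def
proof
  fix b
  have "x \<noteq> r" using assms(4) irr by (auto simp: adj_def)
  let ?S = "{v \<in> V - {r}. \<phi> v = b}"
  have S: "acyclic_on P ?S" using assms by (auto simp: two_dicolours_def)
  show "acyclic_on P {v \<in> V - {x}. (\<phi>(r := \<phi> x)) v = b}"
  proof (cases "b = \<phi> x")
    case False
    show ?thesis by (rule acyclic_on_mono[OF S]) (use False in auto)
  next
    case True
    have "in_nbrs P (?S - {x}) r = {} \<or> out_nbrs P (?S - {x}) r = {}"
    proof (cases "(x, r) \<in> P")
      case True
      then have "x \<in> inn r" using assms by (auto simp: in_nbrs_def)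
      then have "in_nbrs P (?S - {x}) r = {}"
        using nbrs_bichromatic[OF assms(1,2), of "inn r" x] \<open>b = \<phi> x\<close>
        by (auto simp: in_nbrs_def)
      then show ?thesis ..
    next
      case False
      then have "x \<in> outn r" using assms by (auto simp: out_nbrs_def adj_def)
      then have "out_nbrs P (?S - {x}) r = {}"
        using nbrs_bichromatic[OF assms(1,2), of "outn r" x] \<open>b = \<phi> x\<close>
        by (auto simp: out_nbrs_def)
      then show ?thesis ..
    qed
    then have "acyclic_on P (insert r (?S - {x}))"
      using acyclic_on_mono[OF S, of "?S - {x}"] irr by (intro acyclic_on_insert) auto
    then show ?thesis by (rule acyclic_on_mono) (use \<open>x \<noteq> r\<close> in auto)
  qed
qed

text \<open>
  Cycles of the underlying undirected graph, which may have chords. The token sits at the head of the list.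
\<close>

definition cycle_list :: "'a list \<Rightarrow> bool" where
  "cycle_list Z \<longleftrightarrow> distinct Z \<and> 3 \<le> length Z \<and> set Z \<subseteq> V \<and> successively adj (Z @ [hd Z])"

lemma cycle_list_split:
  assumes "cycle_list Z"
  obtains x y zs where "Z = x # y # zs" "zs \<noteq> []"
proof -
  from assms have "3 \<le> length Z" by (simp add: cycle_list_def)
  then show thesis using that
    by (cases Z; cases "tl Z"; cases "tl (tl Z)") auto
qed

lemma cycle_list_rotate1: "cycle_list Z \<Longrightarrow> cycle_list (rotate1 Z)"
  by (rule cycle_list_split[of Z]) (auto simp: cycle_list_def successively_append_iff successively_Cons)

lemma cycle_list_rotate: "cycle_list Z \<Longrightarrow> cycle_list (rotate k Z)"
  by (induction k) (auto intro: cycle_list_rotate1)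

text \<open>
  Moving the token along the cycle \<open>k\<close> times rotates both the list of vertices and the list of colours. These lists have
  lengths \<open>l + 1\<close> and \<open>l\<close>, so after full turns of the token the colours have been shifted by any prescribed amount
  relative to the vertices.
\<close>

lemma rotate_token:
  assumes "cycle_list Z" "two_dicolours P (V - {hd Z}) \<phi>"
  shows "\<exists>\<phi>'. two_dicolours P (V - {hd (rotate k Z)}) \<phi>' \<and>
    map \<phi>' (tl (rotate k Z)) = rotate k (map \<phi> (tl Z)) \<and> (\<forall>v. v \<notin> set Z \<longrightarrow> \<phi>' v = \<phi> v)"
proof (induction k)
  case 0
  show ?case using assms(2) by auto
next
  case (Suc k)
  then obtain \<psi> where \<psi>: "two_dicolours P (V - {hd (rotate k Z)}) \<psi>"
    "map \<psi> (tl (rotate k Z)) = rotate k (map \<phi> (tl Z))" "\<forall>v. v \<notin> set Z \<longrightarrow> \<psi> v = \<phi> v" by blast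
  have cycle_list: "cycle_list (rotate k Z)" using assms(1) by (rule cycle_list_rotate)
  then obtain x y zs where Z: "rotate k Z = x # y # zs" "zs \<noteq> []" by (rule cycle_list_split)
  have V: "x \<in> V" "y \<in> V" "adj x y" "distinct (x # y # zs)"
    using cycle_list by (auto simp: cycle_list_def Z)
  have "x \<in> set Z" by (metis Z(1) list.set_intros(1) set_rotate)
  have "two_dicolours P (V - {y}) (\<psi>(x := \<psi> y))"
    using \<psi>(1) V by (intro shift_token) (auto simp: Z)
  moreover have "map (\<psi>(x := \<psi> y)) (zs @ [x]) = rotate1 (map \<psi> (y # zs))"
    using V(4) by auto
  moreover have "rotate (Suc k) Z = y # zs @ [x]" using Z by simp
  moreover have "rotate (Suc k) (map \<phi> (tl Z)) = rotate1 (map \<psi> (y # zs))"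
    using \<psi>(2) Z by simp
  moreover have "\<forall>v. v \<notin> set Z \<longrightarrow> (\<psi>(x := \<psi> y)) v = \<phi> v" using \<psi>(3) \<open>x \<in> set Z\<close> by auto
  ultimately show ?case by (metis list.sel(1,3))
qed

text \<open>
  If exactly one in-neighbour of the token lies on the cycle, the other one keeps its colour while the colours on the cycle
  rotate; as the two always differ, the rotating colours are all equal. If both lie on the cycle, their colours differ. If none
  does, the two neighbours along the cycle are both out-neighbours, so that again the cycle shows two colours. The same holds with
  the two directions exchanged, which links the numbers of in- and out-neighbours on the cycle.
\<close>

lemma card_nbrs_1_iff_const:
  assumes Z: "cycle_list Z" and \<phi>: "two_dicolours P (V - {hd Z}) \<phi>"
    and N: "N = inn (hd Z) \<and> N' = outn (hd Z) \<or> N = outn (hd Z) \<and> N' = inn (hd Z)"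
  shows "card (N \<inter> set Z) = 1 \<longleftrightarrow> (\<exists>b. \<forall>x\<in>set (tl Z). \<phi> x = b)"
proof -
  obtain z y zs where Zeq: "Z = z # y # zs" "zs \<noteq> []" using Z by (rule cycle_list_split)
  have zV: "z \<in> V" "hd Z = z" using Z by (auto simp: cycle_list_def Zeq)
  have cardN: "card N = 2" "card N' = 2" using N zV card_inn card_outn by auto
  have z_notin: "z \<notin> N" using N irr zV by (auto simp: in_nbrs_def out_nbrs_def)
  have NV: "N \<subseteq> V" "finite N" using N by (auto simp: in_nbrs_def out_nbrs_def fin)
  have bichrom: "\<psi> u \<noteq> \<psi> v"
    if "two_dicolours P (V - {hd Z}) \<psi>" "u \<in> M" "v \<in> M" "u \<noteq> v" "M = N \<or> M = N'" for \<psi> u v M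
    using nbrs_bichromatic[OF _ that(1) _ that(2-4)] N zV that(5) by metis
  define l where "l = length (tl Z)"
  have l: "length Z = Suc l" "0 < l" by (auto simp: l_def Zeq)
  show ?thesis
  proof
    assume "card (N \<inter> set Z) = 1"
    then obtain x where x: "N \<inter> set Z = {x}" by (auto simp: card_1_singleton_iff)
    obtain w where w: "w \<in> N" "w \<noteq> x"
      using cardN(1) by (metis card_2_iff')
    have "w \<notin> set Z" using w x by auto
    have "x \<in> set (tl Z)" using x z_notin by (auto simp: Zeq)
    then obtain p where p: "p < l" "tl Z ! p = x" by (auto simp: in_set_conv_nth l_def)
    have const: "\<phi> (tl Z ! t) = (\<not> \<phi> w)" if t: "t < l" for t
    proof -
      \<comment> \<open>The token makes \<open>m\<close> full turns, each of which shifts the colours by one, since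
        \<open>l + 1 \<equiv> 1\<close> modulo \<open>l\<close>. The value of \<open>m\<close> brings the colour from position \<open>t\<close> to position \<open>p\<close>.\<close>
      define m where "m = t + (l - p)"
      let ?k = "length Z * m"
      have rot: "rotate ?k Z = Z" by (subst rotate_conv_mod) simp
      from rotate_token[OF Z \<phi>, of ?k] obtain \<psi> where \<psi>: "two_dicolours P (V - {hd Z}) \<psi>"
        "map \<psi> (tl Z) = rotate ?k (map \<phi> (tl Z))" "\<psi> w = \<phi> w"
        using \<open>w \<notin> set Z\<close> by (auto simp: rot)
      have "m + p = t + l" using p(1) by (simp add: m_def)
      then have "?k + p = l * m + (t + l)" by (simp add: l(1))
      then have "(?k + p) mod l = (l * m + (t + l)) mod l" by (simp only:)
      also have "\<dots> = t" using t by (simp add: mod_add_eq[symmetric])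
      finally have mod: "(?k + p) mod l = t" .
      have "\<psi> x = map \<psi> (tl Z) ! p" using p by (simp add: l_def)
      also have "\<dots> = rotate ?k (map \<phi> (tl Z)) ! p" by (simp add: \<psi>(2))
      also have "\<dots> = map \<phi> (tl Z) ! ((?k + p) mod l)" using p by (simp add: nth_rotate l_def)
      also have "\<dots> = \<phi> (tl Z ! t)" using t mod by (simp add: l_def)
      finally have "\<psi> x = \<phi> (tl Z ! t)" .
      moreover have "\<psi> x \<noteq> \<psi> w" using bichrom[OF \<psi>(1), of x N w] x w by auto
      ultimately show ?thesis using \<psi>(3) by auto
    qed
    have "\<phi> u = (\<not> \<phi> w)" if "u \<in> set (tl Z)" for u
      using that const unfolding l_def by (metis in_set_conv_nth)
    then show "\<exists>b. \<forall>x\<in>set (tl Z). \<phi> x = b" by blast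
  next
    assume "\<exists>b. \<forall>x\<in>set (tl Z). \<phi> x = b"
    then obtain b where b: "\<And>x. x \<in> set (tl Z) \<Longrightarrow> \<phi> x = b" by auto
    have "card (N \<inter> set Z) \<noteq> 2"
    proof
      assume "card (N \<inter> set Z) = 2"
      then have sub: "N \<subseteq> set Z" using cardN NV card_subset_eq[of N "N \<inter> set Z"] by auto
      obtain u v where "N = {u, v}" "u \<noteq> v" using cardN(1) by (auto simp: card_2_iff)
      then show False
        using bichrom[OF \<phi>, of u N v] b[of u] b[of v] sub z_notin by (auto simp: Zeq)
    qed
    moreover have "card (N \<inter> set Z) \<noteq> 0"
    proof
      assume "card (N \<inter> set Z) = 0"
      then have empty: "N \<inter> set Z = {}" using NV by auto
      have "adj z y" "adj (last zs) z"
        using Z Zeq(2) by (auto simp: cycle_list_def Zeq(1) successively_append_iff successively_Cons)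
      moreover have "last zs \<in> set zs" using Zeq by simp
      ultimately have "y \<in> N'" "last zs \<in> N'"
        using empty N zV Z
        by (auto simp: Zeq(1) adj_def in_nbrs_def out_nbrs_def cycle_list_def)
      moreover have "y \<noteq> last zs" using Z \<open>last zs \<in> set zs\<close> by (auto simp: cycle_list_def Zeq(1))
      ultimately show False
        using bichrom[OF \<phi>, of y N' "last zs"] b[of y] b[of "last zs"] \<open>last zs \<in> set zs\<close>
        by (auto simp: Zeq(1))
    qed
    moreover have "card (N \<inter> set Z) \<le> 2" using card_mono[OF NV(2), of "N \<inter> set Z"] cardN by auto
    ultimately show "card (N \<inter> set Z) = 1" by linarith
  qed
qed

text \<open>
  Being of one colour survives the motion of the token, so the previous lemma applies to every vertex of the cycle.
\<close>

lemma const_card_nbrs: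
  assumes Z: "cycle_list Z" and \<phi>: "two_dicolours P (V - {hd Z}) \<phi>"
    and const: "\<exists>b. \<forall>x\<in>set (tl Z). \<phi> x = b" and t: "t \<in> set Z"
  shows "card (inn t \<inter> set Z) = 1" "card (outn t \<inter> set Z) = 1"
proof -
  obtain k where k: "k < length Z" "Z ! k = t" using t by (auto simp: in_set_conv_nth)
  have "Z \<noteq> []" using t by auto
  then have hd: "hd (rotate k Z) = t" using k by (simp add: hd_rotate_conv_nth)
  from rotate_token[OF Z \<phi>, of k] obtain \<psi> where \<psi>: "two_dicolours P (V - {hd (rotate k Z)}) \<psi>"
    "map \<psi> (tl (rotate k Z)) = rotate k (map \<phi> (tl Z))" by blast
  have "\<psi> ` set (tl (rotate k Z)) = \<phi> ` set (tl Z)"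
    by (metis \<psi>(2) set_map set_rotate)
  then have const': "\<exists>b. \<forall>x\<in>set (tl (rotate k Z)). \<psi> x = b" using const by blast
  show "card (inn t \<inter> set Z) = 1" "card (outn t \<inter> set Z) = 1"
    using card_nbrs_1_iff_const[OF cycle_list_rotate[OF Z] \<psi>(1), of "inn t" "outn t"]
      card_nbrs_1_iff_const[OF cycle_list_rotate[OF Z] \<psi>(1), of "outn t" "inn t"] const' hd by auto
qed

text \<open>
  Let \<open>c\<close>, \<open>d\<close> be the out-neighbours and \<open>a\<close>, \<open>b\<close> the in-neighbours of \<open>r\<close>. There are paths \<open>W\<close> from
  \<open>c\<close> to \<open>a\<close> in one colour and \<open>U\<close> from \<open>d\<close> to \<open>b\<close> in the other one, and a connecting path \<open>p, I, q\<close> from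
  \<open>W\<close> to \<open>U\<close> that avoids \<open>r\<close>. Running from \<open>r\<close> along \<open>W\<close> to \<open>p\<close> from either end, then across, and back along
  \<open>U\<close> from \<open>q\<close> to either end gives four cycles through \<open>r\<close>. Comparing the numbers of in- and out-neighbours of \<open>r\<close> on
  them leaves only two possibilities. Either \<open>W\<close> and \<open>U\<close> are single vertices and \<open>r\<close> lies on two digons. Or \<open>p\<close> and
  \<open>q\<close> are inner vertices of the two paths; then the cycle through \<open>c\<close> and \<open>b\<close> and the cycle through \<open>a\<close> and \<open>d\<close>
  both carry one colour, hence are consistently oriented, but they run through the connecting path with opposite orientations.
\<close>

lemma in_nbrs_eq_out_nbrs:
  assumes r: "r \<in> V"
  shows "inn r = outn r"
proof (rule ccontr)
  assume neq: "inn r \<noteq> outn r"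
  obtain \<phi> where \<phi>: "two_dicolours P (V - {r}) \<phi>" using crit r by blast
  define S where "S b = {v \<in> V - {r}. \<phi> v = b}" for b
  have ex: "\<exists>p q. p \<in> outn r \<and> q \<in> inn r \<and> \<phi> p = b \<and> \<phi> q = b \<and> p \<noteq> r \<and> q \<noteq> r \<and>
      (p, q) \<in> (Restr P (S b))\<^sup>*" for b
    unfolding S_def by (rule blocked[OF r \<phi>, of b]) blast
  obtain c a where ca: "c \<in> outn r" "a \<in> inn r" "\<phi> c" "\<phi> a" "c \<noteq> r" "a \<noteq> r"
    "(c, a) \<in> (Restr P (S True))\<^sup>*"
    using ex[of True] by blast
  obtain d b where db: "d \<in> outn r" "b \<in> inn r" "\<not> \<phi> d" "\<not> \<phi> b" "d \<noteq> r" "b \<noteq> r"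
    "(d, b) \<in> (Restr P (S False))\<^sup>*"
    using ex[of False] by blast
  have inV: "a \<in> V" "b \<in> V" "c \<in> V" "d \<in> V"
    using ca db by (auto simp: in_nbrs_def out_nbrs_def)
  have ab: "inn r = {a, b}" "a \<noteq> b" using card_inn[OF r] ca db by (auto simp: card_2_iff)
  have cd: "outn r = {c, d}" "c \<noteq> d" using card_outn[OF r] ca db by (auto simp: card_2_iff)
  obtain W where W: "W \<noteq> []" "hd W = c" "last W = a" "distinct W"
    "successively (\<lambda>u v. (u, v) \<in> Restr P (S True)) W"
    using rtrancl_distinct_path[OF ca(7)] by blast
  obtain U where U: "U \<noteq> []" "hd U = d" "last U = b" "distinct U"
    "successively (\<lambda>u v. (u, v) \<in> Restr P (S False)) U"
    using rtrancl_distinct_path[OF db(7)] by blast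
  have setW: "set W \<subseteq> S True"
    by (rule successively_Restr_subset[OF W(5,1)]) (use W ca inV in \<open>auto simp: S_def\<close>)
  have setU: "set U \<subseteq> S False"
    by (rule successively_Restr_subset[OF U(5,1)]) (use U db inV in \<open>auto simp: S_def\<close>)
  have WU: "set W \<inter> set U = {}" "r \<notin> set W" "r \<notin> set U" "set W \<subseteq> V" "set U \<subseteq> V"
    using setW setU by (auto simp: S_def)
  have aW: "a \<in> set W" "c \<in> set W" "b \<in> set U" "d \<in> set U"
    using hd_in_set[OF W(1)] last_in_set[OF W(1)] hd_in_set[OF U(1)] last_in_set[OF U(1)] W(2,3) U(2,3)
    by auto
  have adjW: "successively adj W"
    by (rule successively_mono[OF W(5)]) (auto simp: adj_def)
  have adjU: "successively adj U"
    by (rule successively_mono[OF U(5)]) (auto simp: adj_def)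
  define E where "E = Restr (P \<union> P\<inverse>) (V - {r})"
  have "(c, d) \<in> E\<^sup>*"
  proof (rule ccontr)
    \<comment> \<open>Otherwise exchanging the two colours in the component of \<open>c\<close> would give both out-neighbours of \<open>r\<close> the same
      colour.\<close>
    assume cd': "(c, d) \<notin> E\<^sup>*"
    define C where "C = {v. (c, v) \<in> E\<^sup>*}"
    define \<psi> where "\<psi> v = (if v \<in> C then \<not> \<phi> v else \<phi> v)" for v
    have closed: "u \<in> C \<longleftrightarrow> v \<in> C" if "(u, v) \<in> P" "u \<in> V - {r}" "v \<in> V - {r}" for u v
    proof -
      have "(u, v) \<in> E" "(v, u) \<in> E" using that by (auto simp: E_def)
      then show ?thesis by (auto simp: C_def intro: rtrancl.rtrancl_into_rtrancl)
    qed
    have "two_dicolours P (V - {r}) \<psi>"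
      unfolding two_dicolours_def
    proof
      fix b
      let ?X = "{v \<in> V - {r}. \<psi> v = b}"
      have "acyclic_on P (?X \<inter> C)"
        by (rule acyclic_on_mono[of P "{v \<in> V - {r}. \<phi> v = (\<not> b)}"])
          (use \<phi> in \<open>auto simp: two_dicolours_def \<psi>_def\<close>)
      moreover have "acyclic_on P (?X - C)"
        by (rule acyclic_on_mono[of P "{v \<in> V - {r}. \<phi> v = b}"])
          (use \<phi> in \<open>auto simp: two_dicolours_def \<psi>_def\<close>)
      ultimately show "acyclic_on P ?X"
        by (rule acyclic_on_no_return) (use closed in blast)
    qed
    from nbrs_bichromatic[OF r this, of "outn r" c d] ca db cd cd' show False
      by (auto simp: \<psi>_def C_def)
  qed
  then obtain T where T: "T \<noteq> []" "hd T = c" "last T = d" "distinct T"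
    "successively (\<lambda>u v. (u, v) \<in> E) T"
    using rtrancl_distinct_path[of c d E] by blast
  have setT: "set T \<subseteq> V - {r}"
    by (rule successively_Restr_subset[OF T(5)[unfolded E_def] T(1)]) (use T ca inV in auto)
  have adjT: "successively adj T"
    by (rule successively_mono[OF T(5)]) (auto simp: adj_def E_def)
  have "\<exists>x\<in>set T. x \<in> set W" using hd_in_set[OF T(1)] T(2) aW(2) by auto
  then obtain T1 p T2 where T1: "T = T1 @ p # T2" "p \<in> set W" "\<forall>x\<in>set T2. x \<notin> set W"
    using split_list_last_prop[of T "\<lambda>x. x \<in> set W"] by blast
  have "T2 \<noteq> []"
  proof
    assume "T2 = []"
    then have "p = d" using T1(1) T(3) by simp
    then show False using T1(2) aW(4) WU(1) by auto
  qed
  have "last T2 = d" using T1 T(3) \<open>T2 \<noteq> []\<close> by simp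
  then have "\<exists>x\<in>set T2. x \<in> set U" using last_in_set[OF \<open>T2 \<noteq> []\<close>] aW(4) by auto
  then obtain I q T3 where T2: "T2 = I @ q # T3" "q \<in> set U" "\<forall>x\<in>set I. x \<notin> set U"
    using split_list_first_prop[of T2 "\<lambda>x. x \<in> set U"] by blast
  have I: "distinct I" "set I \<inter> set W = {}" "set I \<inter> set U = {}" "r \<notin> set I" "set I \<subseteq> V"
    "successively adj (p # I @ [q])"
    using T1 T2 T(4) setT adjT
    by (auto simp: successively_append_iff successively_Cons hd_append split: if_splits)
  obtain W1 W2 where W12: "W = W1 @ p # W2" using T1(2) by (meson split_list)
  obtain U1 U2 where U12: "U = U1 @ q # U2" using T2(2) by (meson split_list)
  \<comment> \<open>The two ways from \<open>r\<close> along \<open>W\<close> to \<open>p\<close>, and from \<open>q\<close> along \<open>U\<close> back to \<open>r\<close>.\<close>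
  define X1 X2 where X: "X1 = W1 @ [p]" "X2 = rev W2 @ [p]"
  define Y1 Y2 where Y: "Y1 = q # rev U1" "Y2 = q # U2"
  define Z where "Z X Y = r # X @ I @ Y" for X Y
  have adj_rev: "successively (\<lambda>x y. adj y x) xs \<longleftrightarrow> successively adj xs" for xs
    by (intro iffI; erule successively_mono) (auto intro: adj_sym)
  have okX: "X \<noteq> []" "distinct X" "set X \<subseteq> set W" "last X = p" "successively adj X" "adj r (hd X)"
    if "X \<in> {X1, X2}" for X
  proof -
    have "hd X \<in> {a, c}" using that W(2,3)
      by (auto simp: X W12 hd_append hd_rev split: if_splits)
    then show "adj r (hd X)" using ab cd by (auto simp: adj_def in_nbrs_def out_nbrs_def)
    show "X \<noteq> []" "distinct X" "set X \<subseteq> set W" "last X = p" "successively adj X"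
      using that W(4) adjW
      by (auto simp: X W12 successively_append_iff successively_Cons adj_rev last_rev intro: adj_sym)
  qed
  have okY: "Y \<noteq> []" "distinct Y" "set Y \<subseteq> set U" "hd Y = q" "successively adj Y" "adj (last Y) r"
    if "Y \<in> {Y1, Y2}" for Y
  proof -
    have "last Y \<in> {b, d}" using that U(2,3)
      by (auto simp: Y U12 hd_append last_rev split: if_splits)
    then show "adj (last Y) r" using ab cd by (auto simp: adj_def in_nbrs_def out_nbrs_def)
    show "Y \<noteq> []" "distinct Y" "set Y \<subseteq> set U" "hd Y = q" "successively adj Y"
      using that U(4) adjU
      by (auto simp: Y U12 successively_append_iff successively_Cons adj_rev hd_rev intro: adj_sym)
  qed
  have cycZ: "cycle_list (Z X Y)" if "X \<in> {X1, X2}" "Y \<in> {Y1, Y2}" for X Y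
  proof -
    note x = okX[OF that(1)] and y = okY[OF that(2)]
    have "distinct (Z X Y)" "set (Z X Y) \<subseteq> V"
      using x y I WU r unfolding Z_def by auto
    moreover have "3 \<le> length (Z X Y)"
      using x(1) y(1) by (cases X; cases Y) (auto simp: Z_def)
    moreover have "successively adj (Z X Y @ [hd (Z X Y)])"
      using x y I(6) by (cases "I = []") (auto simp: Z_def successively_append_iff successively_Cons)
    ultimately show ?thesis by (simp add: cycle_list_def)
  qed
  have iff: "card (inn r \<inter> set (Z X Y)) = 1 \<longleftrightarrow> card (outn r \<inter> set (Z X Y)) = 1"
    "card (inn r \<inter> set (Z X Y)) = 1 \<longleftrightarrow> (\<exists>b. \<forall>x\<in>set (tl (Z X Y)). \<phi> x = b)"
    if "X \<in> {X1, X2}" "Y \<in> {Y1, Y2}" for X Y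
  proof -
    have hd: "hd (Z X Y) = r" by (simp add: Z_def)
    show "card (inn r \<inter> set (Z X Y)) = 1 \<longleftrightarrow> card (outn r \<inter> set (Z X Y)) = 1"
      "card (inn r \<inter> set (Z X Y)) = 1 \<longleftrightarrow> (\<exists>b. \<forall>x\<in>set (tl (Z X Y)). \<phi> x = b)"
      using card_nbrs_1_iff_const[OF cycZ[OF that], of \<phi> "inn r" "outn r"]
        card_nbrs_1_iff_const[OF cycZ[OF that], of \<phi> "outn r" "inn r"] \<phi>
      by (auto simp: hd)
  qed
  have card1: "card ({x, y} \<inter> set (Z X Y)) = 1 \<longleftrightarrow> (x \<in> set X) \<noteq> (y \<in> set Y)"
    if "X \<in> {X1, X2}" "Y \<in> {Y1, Y2}" "x \<in> set W" "y \<in> set U" for X Y x y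
  proof -
    have "x \<in> set (Z X Y) \<longleftrightarrow> x \<in> set X" "y \<in> set (Z X Y) \<longleftrightarrow> y \<in> set Y" "x \<noteq> y"
      using that okX(3)[OF that(1)] okY(3)[OF that(2)] I WU by (auto simp: Z_def)
    then show ?thesis by (cases "x \<in> set X"; cases "y \<in> set Y") auto
  qed
  \<comment> \<open>The parity condition of the four cycles, in terms of the ends of \<open>W\<close> and \<open>U\<close> that they contain.\<close>
  have par: "((a \<in> set X) \<noteq> (b \<in> set Y)) \<longleftrightarrow> ((c \<in> set X) \<noteq> (d \<in> set Y))"
    if "X \<in> {X1, X2}" "Y \<in> {Y1, Y2}" for X Y
    using iff(1)[OF that] card1[OF that] aW ab cd by auto
  have mem: "c \<in> set X1" "a \<in> set X1 \<longleftrightarrow> W2 = []" "a \<in> set X2" "c \<in> set X2 \<longleftrightarrow> W1 = []"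
    "d \<in> set Y1" "b \<in> set Y1 \<longleftrightarrow> U2 = []" "b \<in> set Y2" "d \<in> set Y2 \<longleftrightarrow> U1 = []"
  proof -
    have "W1 = [] \<Longrightarrow> c = p" "W1 \<noteq> [] \<Longrightarrow> c \<in> set W1" "W2 = [] \<Longrightarrow> a = p" "W2 \<noteq> [] \<Longrightarrow> a \<in> set W2"
      using W(2,3) by (auto simp: W12)
    then show "c \<in> set X1" "a \<in> set X1 \<longleftrightarrow> W2 = []" "a \<in> set X2" "c \<in> set X2 \<longleftrightarrow> W1 = []"
      using W(4) by (auto simp: X W12)
    have "U1 = [] \<Longrightarrow> d = q" "U1 \<noteq> [] \<Longrightarrow> d \<in> set U1" "U2 = [] \<Longrightarrow> b = q" "U2 \<noteq> [] \<Longrightarrow> b \<in> set U2"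
      using U(2,3) by (auto simp: U12)
    then show "d \<in> set Y1" "b \<in> set Y1 \<longleftrightarrow> U2 = []" "b \<in> set Y2" "d \<in> set Y2 \<longleftrightarrow> U1 = []"
      using U(4) by (auto simp: Y U12)
  qed
  have eqs: "W2 = [] \<longleftrightarrow> U2 = []" "W1 = [] \<longleftrightarrow> U1 = []" "W2 = [] \<longleftrightarrow> U1 = []" "W1 = [] \<longleftrightarrow> U2 = []"
    using par[of X1 Y1] par[of X2 Y2] par[of X1 Y2] par[of X2 Y1] mem by auto
  have ne: "W1 \<noteq> []" "W2 \<noteq> []" "U1 \<noteq> []" "U2 \<noteq> []"
  proof -
    have "\<not> (W1 = [] \<and> W2 = [] \<and> U1 = [] \<and> U2 = [])"
      using neq ab cd W(2,3) U(2,3) by (auto simp: W12 U12)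
    then show "W1 \<noteq> []" "W2 \<noteq> []" "U1 \<noteq> []" "U2 \<noteq> []" using eqs by auto
  qed
  have const: "card (inn t \<inter> set (Z X Y)) = 1" "card (outn t \<inter> set (Z X Y)) = 1"
    if "(X, Y) \<in> {(X1, Y2), (X2, Y1)}" "t \<in> set (Z X Y)" for X Y t
  proof -
    have XY: "X \<in> {X1, X2}" "Y \<in> {Y1, Y2}" using that(1) by auto
    have "card (inn r \<inter> set (Z X Y)) = 1"
      unfolding ab(1) using card1[OF XY aW(1,3)] mem that(1) ne by auto
    then have "\<exists>b. \<forall>x\<in>set (tl (Z X Y)). \<phi> x = b" using iff(2)[OF XY] by blast
    from const_card_nbrs[OF cycZ[OF XY] _ this that(2)] \<phi>
    show "card (inn t \<inter> set (Z X Y)) = 1" "card (outn t \<inter> set (Z X Y)) = 1"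
      by (auto simp: Z_def)
  qed
  define x where "x = hd (I @ [q])"
  have Zx: "\<exists>zs. Z X Y = r # X @ x # zs" if "Y \<in> {Y1, Y2}" for X Y
    using okY(1,4)[OF that] by (cases I; cases Y) (auto simp: Z_def x_def)
  have succ: "successively adj (Z X Y)" "distinct (Z X Y)" "set (Z X Y) \<subseteq> V"
    if "X \<in> {X1, X2}" "Y \<in> {Y1, Y2}" for X Y
    using cycZ[OF that] by (auto simp: cycle_list_def successively_append_iff)
  obtain zs where zs: "Z X1 Y2 = r # X1 @ x # zs" using Zx[of Y2 X1] by auto
  obtain zs' where zs': "Z X2 Y1 = r # X2 @ x # zs'" using Zx[of Y1 X2] by auto
  have forward: "successively (\<lambda>u v. (u, v) \<in> P) (Z X1 Y2)"
    unfolding successively_conv_nth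
  proof (intro allI impI, rule directed_propagate[where V = V])
    show "(Z X1 Y2 ! 0, Z X1 Y2 ! 1) \<in> P"
      using ne W(2) cd by (auto simp: Z_def X W12 nth_append hd_conv_nth out_nbrs_def)
    show "successively (\<lambda>u v. (u, v) \<in> P \<or> (v, u) \<in> P) (Z X1 Y2)"
      using succ(1)[of X1 Y2] by (simp add: adj_def[abs_def])
  qed (use succ[of X1 Y2] const(1)[of X1 Y2] in auto)
  have backward: "successively (\<lambda>u v. (u, v) \<in> P\<inverse>) (Z X2 Y1)"
    unfolding successively_conv_nth
  proof (intro allI impI, rule directed_propagate[where V = V])
    show "(Z X2 Y1 ! 0, Z X2 Y1 ! 1) \<in> P\<inverse>"
      using ne W(3) ab by (auto simp: Z_def X W12 nth_append hd_conv_nth[symmetric] hd_rev in_nbrs_def)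
    show "successively (\<lambda>u v. (u, v) \<in> P\<inverse> \<or> (v, u) \<in> P\<inverse>) (Z X2 Y1)"
      by (rule successively_mono[OF succ(1)[of X2 Y1]]) (auto simp: adj_def)
  qed (use succ[of X2 Y1] const(2)[of X2 Y1] in auto)
  obtain W1' y where W1': "W1 = W1' @ [y]" using ne(1) by (cases W1 rule: rev_cases) auto
  have Z12: "Z X1 Y2 = r # W1' @ [y] @ p # x # zs" using zs by (simp add: X W1')
  have Z21: "Z X2 Y1 = r # rev W2 @ p # x # zs'" using zs' by (simp add: X)
  have "(p, x) \<in> P" "(y, p) \<in> P"
    using forward unfolding Z12
    by (auto simp: successively_append_iff successively_Cons)
  moreover have "(x, p) \<in> P"
    using backward unfolding Z21
    by (auto simp: successively_append_iff successively_Cons)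
  moreover have xy: "x \<in> set (Z X1 Y2)" "y \<in> set (Z X1 Y2)" "p \<in> set (Z X1 Y2)" "x \<noteq> y"
    using succ(2)[of X1 Y2] by (auto simp: Z12)
  ultimately have "x \<in> inn p \<inter> set (Z X1 Y2)" "y \<in> inn p \<inter> set (Z X1 Y2)"
    using succ(3)[of X1 Y2] by (auto simp: in_nbrs_def)
  moreover have "card (inn p \<inter> set (Z X1 Y2)) = 1" using const(1)[of X1 Y2 p] xy by simp
  ultimately show False using xy(4) by (metis card_1_singletonE singletonD)
qed

text \<open>
  All arcs belong to digons, so every arc joins vertices on different sides of \<open>s\<close>.
\<close>

lemma no_critical: False
proof -
  have "two_dicolours P V s"
    unfolding two_dicolours_def
  proof
    fix b
    have "(v, u) \<in> P" if "(u, v) \<in> P" "u \<in> V" "v \<in> V" for u v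
      using in_nbrs_eq_out_nbrs[OF that(2)] that by (auto simp: in_nbrs_def out_nbrs_def)
    then have "Restr P {v \<in> V. s v = b} = {}" using digon by blast
    then show "acyclic_on P {v \<in> V. s v = b}" by (simp add: acyclic_on_def acyclic_def)
  qed
  then show False using not_col by blast
qed

end

text \<open>
  The directed Brooks theorem in degree 2. Some restriction on the digons is necessary: a bidirected odd cycle is not
  2-dicolourable.
\<close>

lemma two_colourable_in_degree_2:
  fixes P :: "'a rel" and s :: "'a \<Rightarrow> bool"
  assumes "finite V" "\<And>v. (v, v) \<notin> P"
    "\<And>v. v \<in> V \<Longrightarrow> card (in_nbrs P V v) \<le> 2"
    "\<And>u v. u \<in> V \<Longrightarrow> v \<in> V \<Longrightarrow> (u, v) \<in> P \<Longrightarrow> (v, u) \<in> P \<Longrightarrow> s u \<noteq> s v"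
  shows "\<exists>\<phi>. two_dicolours P V \<phi>"
  using assms(1,3,4)
proof (induction V rule: finite_psubset_induct)
  case (psubset V)
  show ?case
  proof (rule ccontr)
    assume not: "\<nexists>\<phi>. two_dicolours P V \<phi>"
    interpret critical P V s
    proof
      fix v assume v: "v \<in> V"
      show "\<exists>\<phi>. two_dicolours P (V - {v}) \<phi>"
      proof (rule psubset.IH)
        fix u assume "u \<in> V - {v}"
        have "card (in_nbrs P (V - {v}) u) \<le> card (in_nbrs P V u)"
          using psubset.hyps by (intro card_mono) (auto simp: in_nbrs_def)
        also have "\<dots> \<le> 2" using psubset.prems \<open>u \<in> V - {v}\<close> by auto
        finally show "card (in_nbrs P (V - {v}) u) \<le> 2" .
      qed (use v psubset.prems in auto)
    qed (use psubset.hyps psubset.prems assms(2) not in blast)+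
    show False by (rule no_critical)
  qed
qed

text \<open>
  The set \<open>A\<close> collects the vertices of small in-degree, and \<open>P\<close> is the parent relation. A \<open>P\<close>-dicolouring works for
  \<open>r\<close>: an arc from outside \<open>A\<close> into \<open>A\<close> is a digon of \<open>P\<close>, so it is not monochromatic, and a monochromatic cycle
  would therefore stay inside \<open>A\<close>, where \<open>r\<close> agrees with \<open>P\<close>, or outside \<open>A\<close>, where \<open>r\<close> agrees with the converse of
  \<open>P\<close>.
\<close>

lemma two_colourable_min_degree_2:
  assumes V: "finite V" and r: "asym r" and deg: "min_degree_le r V 2"
  shows "\<exists>\<phi>. two_dicolours r V \<phi>"
proof -
  define A where "A = {v \<in> V. card (in_nbrs r V v) \<le> 2}"
  define P where "P = {(u, v). u \<in> V \<and> v \<in> V \<and> (if v \<in> A then (u, v) \<in> r else (v, u) \<in> r)}"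
  have asym: "(u, v) \<in> r \<Longrightarrow> (v, u) \<notin> r" for u v using r by (auto dest: asymD)
  have "\<exists>\<phi>. two_dicolours P V \<phi>"
  proof (rule two_colourable_in_degree_2[where s = "\<lambda>v. v \<in> A", OF V])
    show "(v, v) \<notin> P" for v using asym by (auto simp: P_def)
    show "card (in_nbrs P V v) \<le> 2" if "v \<in> V" for v
    proof (cases "v \<in> A")
      case True
      then have "in_nbrs P V v = in_nbrs r V v" using that by (auto simp: in_nbrs_def P_def)
      then show ?thesis using True by (simp add: A_def)
    next
      case False
      then have "in_nbrs P V v = out_nbrs r V v"
        using that by (auto simp: in_nbrs_def out_nbrs_def P_def)
      then show ?thesis using False that deg by (auto simp: A_def min_degree_le_def)
    qed
    show "(u \<in> A) \<noteq> (v \<in> A)" if "(u, v) \<in> P" "(v, u) \<in> P" for u v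
      using that asym by (auto simp: P_def split: if_splits)
  qed
  then obtain \<phi> where \<phi>: "two_dicolours P V \<phi>" by blast
  have "two_dicolours r V \<phi>"
    unfolding two_dicolours_def
  proof
    fix b
    let ?X = "{v \<in> V. \<phi> v = b}"
    have X: "acyclic (Restr P ?X)" using \<phi> by (simp add: two_dicolours_def acyclic_on_def)
    show "acyclic_on r ?X"
    proof (rule acyclic_on_no_return[where C = "- A"])
      have "acyclic_on (r\<inverse>) (?X \<inter> - A)"
        unfolding acyclic_on_def by (rule acyclic_subset[OF X]) (auto simp: P_def)
      then show "acyclic_on r (?X \<inter> - A)" by simp
      show "acyclic_on r (?X - - A)"
        unfolding acyclic_on_def by (rule acyclic_subset[OF X]) (auto simp: P_def)
      show "(u, v) \<notin> r" if u: "u \<in> ?X \<inter> - A" and v: "v \<in> ?X - - A" for u v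
      proof
        assume "(u, v) \<in> r"
        then have "(u, v) \<in> Restr P ?X" "(v, u) \<in> Restr P ?X" using u v by (auto simp: P_def)
        then have "(u, u) \<in> (Restr P ?X)\<^sup>+" by (meson trancl.intros)
        then show False using X by (auto simp: acyclic_def)
      qed
    qed
  qed
  then show ?thesis by blast
qed

section \<open>Two colours when the minimum degree is at most one\<close>

lemma card_ge_2I: "finite N \<Longrightarrow> x \<in> N \<Longrightarrow> y \<in> N \<Longrightarrow> x \<noteq> y \<Longrightarrow> \<not> card N \<le> 1"
  using card_mono[of N "{x, y}"] by auto

text \<open>
  \<open>S\<close> and \<open>T\<close> are the colour classes of the present colouring, and the target has the classes \<open>V - M\<close> and
  \<open>M\<close>. If no vertex can be moved to its target class, then each vertex that should move closes a cycle with the other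
  class. It thus has an in- and an out-neighbour there, and by the degree bound one of the two is unique. Starting from \<open>w \<in> T - M\<close> with a single out-neighbour \<open>v\<close>, follow the
  cycle that \<open>w\<close> closes with \<open>S\<close>: it runs from \<open>v\<close> to the in-neighbour \<open>t\<close> of \<open>w\<close>, and \<open>v\<close> has the single
  in-neighbour \<open>w\<close>. The vertex \<open>y\<close> after \<open>v\<close> yields a contradiction in each case.
\<close>

lemma not_frozen_out:
  assumes V: "finite V" and r: "asym r" and deg: "min_degree_le r V 1"
    and S: "V = S \<union> T" "S \<inter> T = {}" "acyclic_on r S" "acyclic_on r T"
    and M: "M \<subseteq> V" "acyclic_on r M" "\<And>v. v \<in> V - M \<Longrightarrow> \<not> acyclic_on r (insert v M)"
    and frozen: "\<And>x. x \<in> S \<inter> M \<Longrightarrow> \<not> acyclic_on r (insert x T)"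
      "\<And>x. x \<in> T - M \<Longrightarrow> \<not> acyclic_on r (insert x S)"
    and w: "w \<in> T - M" and out_w: "card (out_nbrs r V w) \<le> 1"
  shows False
proof -
  have asym: "(u, v) \<in> r \<Longrightarrow> (v, u) \<notin> r" for u v using r by (auto dest: asymD)
  have irr: "(u, u) \<notin> r" for u using asym by blast
  have uniq_out: "u = u'" if "card (out_nbrs r V x) \<le> 1" "(x, u) \<in> r" "(x, u') \<in> r" "u \<in> V" "u' \<in> V" for x u u'
    using card_ge_2I[of "out_nbrs r V x" u u'] that V by (auto simp: out_nbrs_def)
  have uniq_in: "u = u'" if "card (in_nbrs r V x) \<le> 1" "(u, x) \<in> r" "(u', x) \<in> r" "u \<in> V" "u' \<in> V" for x u u'
    using card_ge_2I[of "in_nbrs r V x" u u'] that V by (auto simp: in_nbrs_def)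
  have deg': "card (in_nbrs r V x) \<le> 1 \<or> card (out_nbrs r V x) \<le> 1" if "x \<in> V" for x
    using deg that by (auto simp: min_degree_le_def)
  obtain v t where vt: "v \<in> S" "t \<in> S" "(w, v) \<in> r" "(t, w) \<in> r" "(v, t) \<in> (Restr r S)\<^sup>*"
    using new_cycle_path[OF S(3) frozen(2)[OF w] irr] by blast
  have "w \<in> V - M" using w S by auto
  from nbrs_in_maximal(2)[OF M(2) M(3)[OF this] irr]
  obtain m where "m \<in> M" "(w, m) \<in> r" by (auto simp: out_nbrs_def)
  then have "v \<in> M" using uniq_out[OF out_w, of v m] vt S M(1) by auto
  \<comment> \<open>A vertex \<open>x\<close> on that cycle, with a predecessor in \<open>S\<close>, cannot wait to be moved to \<open>T\<close>. The cycle that it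
    closes with \<open>T\<close> supplies a second in-neighbour, so \<open>x\<close> has a single out-neighbour. Following arcs out of \<open>x\<close>,
    the one cycle stays in \<open>T\<close> for two steps, the other one is in \<open>S\<close> after one or two steps.\<close>
  have escape: False if x: "x \<in> S \<inter> M" "z \<in> S" "(z, x) \<in> r" "(x, t) \<in> (Restr r S)\<^sup>*" for x z
  proof -
    obtain a b where ab: "a \<in> T" "b \<in> T" "(x, a) \<in> r" "(b, x) \<in> r" "(a, b) \<in> (Restr r T)\<^sup>*"
      using new_cycle_path[OF S(4) frozen(1)[OF x(1)] irr] by blast
    have "a \<noteq> b" using ab asym by auto
    then obtain a' where a': "(a, a') \<in> r" "a' \<in> T" using ab(5) by (auto elim: converse_rtranclE)
    have "z \<noteq> b" using x(2) ab(2) S(2) by auto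
    then have "card (out_nbrs r V x) \<le> 1"
      using uniq_in[of x z b] x ab S deg'[of x] by auto
    note out_x = uniq_out[OF this _ ab(3)]
    show False
    proof (cases "x = t")
      case True
      then have "w = a" using out_x[of w] vt ab S w by auto
      then have "v = a'" using uniq_out[OF out_w, of v a'] vt a' S by auto
      then show False using vt a' S by auto
    next
      case False
      then obtain x' where "(x, x') \<in> Restr r S" using x(4) by (auto elim: converse_rtranclE)
      then show False using out_x[of x'] ab S by auto
    qed
  qed
  have "v \<noteq> t" using vt asym by auto
  then obtain y where y: "(v, y) \<in> Restr r S" "(y, t) \<in> (Restr r S)\<^sup>*"
    using vt(5) by (auto elim: converse_rtranclE)
  obtain a where a: "a \<in> T" "(v, a) \<in> r"
    using new_cycle_path[OF S(4) frozen(1)[of v] irr] vt \<open>v \<in> M\<close> by blast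
  have "y \<noteq> a" using y a S by auto
  then have in_v: "card (in_nbrs r V v) \<le> 1"
    using uniq_out[of v y a] y a S deg'[of v] vt by auto
  show False
  proof (cases "y \<in> M")
    case True
    then show False using escape[of y v] y by auto
  next
    case False
    then have yM: "y \<in> V - M" using y S by auto
    note max_y = M(3)[OF yM]
    show False
    proof (cases "card (in_nbrs r V y) \<le> 1")
      case True
      \<comment> \<open>Every cycle through \<open>y\<close> passes through \<open>v\<close> and then through \<open>w \<notin> M\<close>. So \<open>y\<close> could be added to \<open>M\<close>.\<close>
      obtain b c where bc: "b \<in> M" "c \<in> M" "(y, b) \<in> r" "(c, y) \<in> r" "(b, c) \<in> (Restr r M)\<^sup>*"
        using new_cycle_path[OF M(2) max_y irr] by blast
      then have "c = v" using uniq_in[OF True, of c v] y M(1) S by auto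
      moreover have "b \<noteq> c" using bc asym by auto
      ultimately obtain u where "(u, v) \<in> Restr r M" using bc(5) by (auto elim: rtranclE)
      then have "u = w" using uniq_in[OF in_v, of u w] M(1) S w vt by auto
      then show False using \<open>(u, v) \<in> Restr r M\<close> w by auto
    next
      case False
      then have out_y: "card (out_nbrs r V y) \<le> 1" using deg'[of y] yM by auto
      obtain b where b: "b \<in> M" "(y, b) \<in> r"
        using nbrs_in_maximal(2)[OF M(2) max_y irr] by (auto simp: out_nbrs_def)
      have "y \<noteq> t"
        using uniq_out[OF out_y, of w b] vt b w M(1) S by auto
      then obtain y' where y': "(y, y') \<in> Restr r S" "(y', t) \<in> (Restr r S)\<^sup>*"
        using y(2) by (auto elim: converse_rtranclE)
      then have "y' = b" using uniq_out[OF out_y, of y' b] b M(1) S by auto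
      then show False using escape[of y' y] y' b by auto
    qed
  qed
qed

text \<open>
  It is enough to exclude waiting vertices in \<open>T - M\<close>: if there are none, then \<open>T \<subseteq> M\<close>, and as \<open>M\<close> is acyclic,
  any vertex of \<open>S \<inter> M\<close> can be moved. By the symmetry of reversing all arcs, the single neighbour may be taken to be an
  out-neighbour.
\<close>

lemma not_frozen:
  assumes V: "finite V" and r: "asym r" and deg: "min_degree_le r V 1"
    and S: "V = S \<union> T" "S \<inter> T = {}" "acyclic_on r S" "acyclic_on r T"
    and M: "M \<subseteq> V" "acyclic_on r M" "\<And>v. v \<in> V - M \<Longrightarrow> \<not> acyclic_on r (insert v M)"
    and "T \<noteq> M"
  shows "(\<exists>x\<in>S \<inter> M. acyclic_on r (insert x T)) \<or> (\<exists>x\<in>T - M. acyclic_on r (insert x S))"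
proof (rule ccontr)
  assume "\<not> ?thesis"
  then have frozen: "\<And>x. x \<in> S \<inter> M \<Longrightarrow> \<not> acyclic_on r (insert x T)"
    "\<And>x. x \<in> T - M \<Longrightarrow> \<not> acyclic_on r (insert x S)" by auto
  have "T \<subseteq> M"
  proof
    fix w assume "w \<in> T"
    show "w \<in> M"
    proof (rule ccontr)
      assume "w \<notin> M"
      then have w: "w \<in> T - M" using \<open>w \<in> T\<close> by auto
      have "card (in_nbrs r V w) \<le> 1 \<or> card (out_nbrs r V w) \<le> 1"
        using deg w S by (auto simp: min_degree_le_def)
      then show False
      proof
        assume "card (out_nbrs r V w) \<le> 1"
        then show False using not_frozen_out[of V r S T M w] V r deg S M frozen w by blast
      next
        assume "card (in_nbrs r V w) \<le> 1"
        then have "card (out_nbrs (r\<inverse>) V w) \<le> 1" by simp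
        then show False
          using not_frozen_out[of V "r\<inverse>" S T M w] V r deg S M frozen w by simp
      qed
    qed
  qed
  then obtain x where "x \<in> S \<inter> M" using \<open>T \<noteq> M\<close> M(1) S(1) by auto
  then show False
    using frozen(1)[of x] acyclic_on_mono[OF M(2), of "insert x T"] \<open>T \<subseteq> M\<close> by auto
qed

lemma recolours_to_maximal:
  assumes V: "finite V" and r: "asym r" and deg: "min_degree_le r V 1" and pq: "p \<noteq> q"
    and M: "M \<subseteq> V" "acyclic_on r M" "\<And>v. v \<in> V - M \<Longrightarrow> \<not> acyclic_on r (insert v M)"
    and \<phi>: "dicolours r V {p, q} \<phi>"
  shows "recolours r V {p, q} (card {v \<in> V. \<phi> v \<noteq> (if v \<in> M then q else p)}) \<phi>
    (\<lambda>v. if v \<in> M then q else p)"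
  using \<phi>
proof (induction "card {v \<in> V. \<phi> v \<noteq> (if v \<in> M then q else p)}" arbitrary: \<phi>)
  case 0
  then have "{v \<in> V. \<phi> v \<noteq> (if v \<in> M then q else p)} = {}" using V by simp
  then have "\<forall>v\<in>V. \<phi> v = (if v \<in> M then q else p)" by blast
  then show ?case using 0 by (intro recolours.refl)
next
  case (Suc n)
  let ?g = "\<lambda>v. if v \<in> M then q else p"
  let ?S = "{v \<in> V. \<phi> v = p}" and ?T = "{v \<in> V. \<phi> v = q}"
  have ST: "V = ?S \<union> ?T" "?S \<inter> ?T = {}" "acyclic_on r ?S" "acyclic_on r ?T"
    using Suc.prems pq by (auto simp: dicolours_def)
  have "?T \<noteq> M"
  proof
    assume "?T = M"
    have "{v \<in> V. \<phi> v \<noteq> ?g v} \<noteq> {}" using Suc.hyps(2) by (metis card.empty nat.distinct(1))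
    then obtain u where u: "u \<in> V" "\<phi> u \<noteq> ?g u" by blast
    have "u \<in> M \<longleftrightarrow> \<phi> u = q" using \<open>?T = M\<close> u(1) by blast
    then show False using u ST(1) by (auto split: if_splits)
  qed
  note move = not_frozen[OF V r deg ST M this]
  obtain x where x: "x \<in> V" "\<phi> x \<noteq> ?g x" "dicolours r V {p, q} (\<phi>(x := ?g x))"
  proof -
    from move consider x where "x \<in> ?S \<inter> M" "acyclic_on r (insert x ?T)"
      | x where "x \<in> ?T - M" "acyclic_on r (insert x ?S)" by blast
    then show thesis
    proof cases
      case 1
      have "acyclic_on r {v \<in> V. (\<phi>(x := ?g x)) v = i}" for i
      proof (cases "i = q")
        case True
        show ?thesis by (rule acyclic_on_mono[OF 1(2)]) (use True in auto)
      next
        case False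
        show ?thesis
          by (rule acyclic_on_mono[of r "{v \<in> V. \<phi> v = i}"])
            (use False 1 Suc.prems in \<open>auto simp: dicolours_def\<close>)
      qed
      then have "dicolours r V {p, q} (\<phi>(x := ?g x))"
        using Suc.prems unfolding dicolours_def by simp
      then show thesis using 1 pq by (intro that[of x]) auto
    next
      case 2
      have "acyclic_on r {v \<in> V. (\<phi>(x := ?g x)) v = i}" for i
      proof (cases "i = p")
        case True
        show ?thesis by (rule acyclic_on_mono[OF 2(2)]) (use True in auto)
      next
        case False
        show ?thesis
          by (rule acyclic_on_mono[of r "{v \<in> V. \<phi> v = i}"])
            (use False 2 Suc.prems in \<open>auto simp: dicolours_def\<close>)
      qed
      then have "dicolours r V {p, q} (\<phi>(x := ?g x))"
        using Suc.prems unfolding dicolours_def by simp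
      then show thesis using 2 pq by (intro that[of x]) auto
    qed
  qed
  let ?\<psi> = "\<phi>(x := ?g x)"
  have "{v \<in> V. \<phi> v \<noteq> ?g v} = insert x {v \<in> V. ?\<psi> v \<noteq> ?g v}" using x by auto
  moreover have "x \<notin> {v \<in> V. ?\<psi> v \<noteq> ?g v}" by auto
  ultimately have card: "Suc n = Suc (card {v \<in> V. ?\<psi> v \<noteq> ?g v})"
    using Suc.hyps(2) V by simp
  then have "recolours r V {p, q} n ?\<psi> ?g" using Suc.hyps(1)[of ?\<psi>] x(3) by simp
  moreover have "recolours r V {p, q} 1 \<phi> ?\<psi>"
    using recolours.step[OF recolours.refl[OF Suc.prems, of \<phi> 0] x(3), of x] by simp
  ultimately have "recolours r V {p, q} (1 + n) \<phi> ?g" by (rule recolours_trans)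
  then show ?case using Suc.hyps(2) by simp
qed

lemma recolours_two_colours:
  assumes "finite V" "asym r" "min_degree_le r V 1" "p \<noteq> q"
    and "dicolours r V {p, q} \<phi>" "dicolours r V {p, q} \<psi>"
  shows "recolours r V {p, q} (2 * card V) \<phi> \<psi>"
proof -
  obtain M where M: "M \<subseteq> V" "acyclic_on r M" "\<And>v. v \<in> V - M \<Longrightarrow> \<not> acyclic_on r (insert v M)"
    using maximal_acyclic_extension[of V "{}" r] assms(1) by auto
  have "recolours r V {p, q} (card V) \<chi> (\<lambda>v. if v \<in> M then q else p)" if "dicolours r V {p, q} \<chi>" for \<chi>
    by (rule recolours_mono[OF recolours_to_maximal[OF assms(1-4) M that]])
      (use assms(1) in \<open>auto intro: card_mono\<close>)
  from recolours_trans[OF recolours_sym[OF this[OF assms(6)]] this[OF assms(5)]] show ?thesis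
    by (simp only: mult_2)
qed

section \<open>Bounding the recolouring distance\<close>

lemma dicolours_override:
  assumes "dicolours r (V - J) L \<chi>" "L \<subseteq> K" "\<And>v. v \<in> J \<Longrightarrow> f v \<in> K - L"
    "\<And>i. acyclic_on r {v \<in> J. f v = i}"
  shows "dicolours r V K (\<lambda>v. if v \<in> J then f v else \<chi> v)"
proof -
  have \<chi>: "\<chi> v \<in> L" if "v \<in> V" "v \<notin> J" for v using assms(1) that by (auto simp: dicolours_def)
  show ?thesis
    unfolding dicolours_def
  proof (intro conjI ballI allI)
    show "(if v \<in> J then f v else \<chi> v) \<in> K" if "v \<in> V" for v
      using assms that by (auto simp: dicolours_def)
    show "acyclic_on r {v \<in> V. (if v \<in> J then f v else \<chi> v) = i}" for i
    proof (cases "i \<in> L")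
      case True
      show ?thesis
        by (rule acyclic_on_mono[of r "{v \<in> V - J. \<chi> v = i}"])
          (use True assms in \<open>auto simp: dicolours_def\<close>)
    next
      case False
      have "v \<in> J \<and> f v = i" if "v \<in> V" "(if v \<in> J then f v else \<chi> v) = i" for v
        using \<chi>[OF that(1)] that False by (cases "v \<in> J") auto
      then show ?thesis by (intro acyclic_on_mono[OF assms(4)[of i]]) blast
    qed
  qed
qed

text \<open>
  Fix two colours \<open>p\<close> and \<open>q\<close>. By symmetry, \<open>\<psi>\<close> may be assumed to use them on at most as many vertices as \<open>\<phi>\<close>. First
  recolour the set \<open>X\<close> where \<open>\<phi>\<close> uses other colours with \<open>p\<close> and \<open>q\<close>, then give the set \<open>B\<close> where \<open>\<psi>\<close>
  uses other colours its final colours, which are free by now, and finally use the two-colour case on \<open>V - B\<close>. The cost is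
  \<open>|X| + |B| + 2|V - B| = n + |X| + |V - B|\<close>, and \<open>|V - B| \<le> |V - X|\<close> by the assumption.
\<close>

lemma recolours_min_degree_1:
  assumes V: "finite V" and r: "asym r" and deg: "min_degree_le r V 1" and K: "2 \<le> card K"
    and \<phi>: "dicolours r V K \<phi>" and \<psi>: "dicolours r V K \<psi>"
  shows "recolours r V K (2 * card V) \<phi> \<psi>"
proof -
  have "finite K" using K by (auto intro: card_ge_0_finite)
  then obtain p q where pq: "p \<in> K" "q \<in> K" "p \<noteq> q"
    using K by (metis card_2_iff' obtain_subset_with_card_n subsetD)
  have directed: "recolours r V K (2 * card V) \<phi> \<psi>"
    if \<phi>: "dicolours r V K \<phi>" and \<psi>: "dicolours r V K \<psi>"
      and le: "card {v \<in> V. \<psi> v \<in> {p, q}} \<le> card {v \<in> V. \<phi> v \<in> {p, q}}" for \<phi> \<psi>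
  proof -
    define Fp Fq X where "Fp = {v \<in> V. \<phi> v = p}" and "Fq = {v \<in> V. \<phi> v = q}"
      and "X = {v \<in> V. \<phi> v \<notin> {p, q}}"
    have acyc: "acyclic_on r Fp" "acyclic_on r Fq" "acyclic_on r {v \<in> V. \<phi> v = i}"
      "acyclic_on r {v \<in> V. \<psi> v = i}" for i
      using \<phi> \<psi> by (auto simp: dicolours_def Fp_def Fq_def)
    obtain J where J: "Fp \<subseteq> J" "J \<subseteq> Fp \<union> X" "acyclic_on r J"
      "\<And>v. v \<in> Fp \<union> X - J \<Longrightarrow> \<not> acyclic_on r (insert v J)"
      using maximal_acyclic_extension[of "Fp \<union> X" Fp r] V acyc(1)
      by (auto simp: Fp_def X_def)
    \<comment> \<open>A vertex of \<open>X\<close> outside \<open>J\<close> has its only in-neighbour or its only out-neighbour in \<open>J\<close>.\<close>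
    have rest: "acyclic_on r (Fq \<union> (X - J))"
    proof (rule acyclic_on_Un)
      fix v assume v: "v \<in> X - J"
      show irr: "(v, v) \<notin> r" using r by (auto dest: asymD)
      have "in_nbrs r J v \<noteq> {}" "out_nbrs r J v \<noteq> {}"
        using nbrs_in_maximal[OF J(3) J(4) irr] v by auto
      then obtain a b where ab: "a \<in> J" "(a, v) \<in> r" "b \<in> J" "(v, b) \<in> r"
        by (auto simp: in_nbrs_def out_nbrs_def)
      have sub: "J \<subseteq> V" "Fq \<union> (X - J) \<subseteq> V" "J \<inter> (Fq \<union> (X - J)) = {}" "v \<in> V"
        using J(2) v pq(3) by (auto simp: Fp_def Fq_def X_def)
      show "in_nbrs r (Fq \<union> (X - J)) v = {} \<or> out_nbrs r (Fq \<union> (X - J)) v = {}"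
      proof (rule ccontr)
        assume "\<not> ?thesis"
        then obtain a' b' where ab': "a' \<in> Fq \<union> (X - J)" "(a', v) \<in> r" "b' \<in> Fq \<union> (X - J)" "(v, b') \<in> r"
          unfolding in_nbrs_def out_nbrs_def by blast
        have "a \<in> V" "b \<in> V" "a' \<in> V" "b' \<in> V" "a \<noteq> a'" "b \<noteq> b'" using ab ab' sub by blast+
        then have "\<not> card (in_nbrs r V v) \<le> 1" "\<not> card (out_nbrs r V v) \<le> 1"
          using card_ge_2I[of "in_nbrs r V v" a a'] card_ge_2I[of "out_nbrs r V v" b b'] V ab ab'
          by (auto simp: in_nbrs_def out_nbrs_def)
        then show False using deg sub(4) unfolding min_degree_le_def by blast
      qed
    qed (use V acyc in \<open>auto simp: X_def\<close>)
    define \<phi>1 where "\<phi>1 v = (if v \<in> X then if v \<in> J then p else q else \<phi> v)" for v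
    have \<phi>1: "\<phi>1 v \<in> {p, q}" if "v \<in> V" for v using that by (auto simp: \<phi>1_def X_def)
    have mixed: "dicolours r V K \<chi>" if \<chi>: "\<And>v. v \<in> V \<Longrightarrow> \<chi> v = \<phi> v \<or> \<chi> v = \<phi>1 v" for \<chi>
      unfolding dicolours_def
    proof (intro conjI ballI allI)
      show "\<chi> v \<in> K" if "v \<in> V" for v
        using \<chi>[OF that] \<phi>1[OF that] \<phi> pq that by (auto simp: dicolours_def)
      show "acyclic_on r {v \<in> V. \<chi> v = i}" for i
      proof -
        consider "i = p" | "i = q" | "i \<notin> {p, q}" by auto
        then show ?thesis
        proof cases
          case 1
          have "v \<in> J" if "v \<in> V" "\<chi> v = p" for v
            using \<chi>[OF that(1)] that J(1) pq(3) by (auto simp: \<phi>1_def X_def Fp_def split: if_splits)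
          then show ?thesis using 1 by (intro acyclic_on_mono[OF J(3)]) blast
        next
          case 2
          have "v \<in> Fq \<union> (X - J)" if "v \<in> V" "\<chi> v = q" for v
            using \<chi>[OF that(1)] that pq(3) by (auto simp: \<phi>1_def X_def Fq_def split: if_splits)
          then show ?thesis using 2 by (intro acyclic_on_mono[OF rest]) blast
        next
          case 3
          have "\<phi> v = i" if "v \<in> V" "\<chi> v = i" for v
            using \<chi>[OF that(1)] \<phi>1[OF that(1)] that 3 by auto
          then show ?thesis by (intro acyclic_on_mono[OF acyc(3)[of i]]) blast
        qed
      qed
    qed
    have stage1: "recolours r V K (card X) \<phi> \<phi>1"
      by (rule recolours_mono[OF recolours_mix[OF V \<phi> mixed]])
        (use V in \<open>auto simp: X_def \<phi>1_def intro!: card_mono\<close>)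
    define B where "B = {v \<in> V. \<psi> v \<notin> {p, q}}"
    define \<phi>2 where "\<phi>2 v = (if v \<in> B then \<psi> v else \<phi>1 v)" for v
    have dic1: "dicolours r V K \<phi>1" using mixed by blast
    have mixed2: "dicolours r V K \<chi>" if \<chi>: "\<And>v. v \<in> V \<Longrightarrow> \<chi> v = \<phi>1 v \<or> \<chi> v = \<phi>2 v" for \<chi>
      unfolding dicolours_def
    proof (intro conjI ballI allI)
      show "\<chi> v \<in> K" if "v \<in> V" for v
        using \<chi>[OF that] \<phi>1[OF that] \<psi> pq that by (auto simp: dicolours_def \<phi>2_def)
      show "acyclic_on r {v \<in> V. \<chi> v = i}" for i
      proof (cases "i \<in> {p, q}")
        case True
        have *: "acyclic_on r {v \<in> V. \<phi>1 v = i}" using dic1 by (simp add: dicolours_def)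
        have "\<phi>1 v = i" if "v \<in> V" "\<chi> v = i" for v
          using \<chi>[OF that(1)] that True by (auto simp: \<phi>2_def B_def split: if_splits)
        then show ?thesis by (intro acyclic_on_mono[OF *]) blast
      next
        case False
        have "\<psi> v = i" if "v \<in> V" "\<chi> v = i" for v
          using \<chi>[OF that(1)] \<phi>1[OF that(1)] that False by (auto simp: \<phi>2_def split: if_splits)
        then show ?thesis by (intro acyclic_on_mono[OF acyc(4)[of i]]) blast
      qed
    qed
    have stage2: "recolours r V K (card B) \<phi>1 \<phi>2"
      by (rule recolours_mono[OF recolours_mix[OF V dic1 mixed2]])
        (use V in \<open>auto simp: B_def \<phi>2_def intro!: card_mono\<close>)
    have "recolours r (V - B) {p, q} (2 * card (V - B)) \<phi>1 \<psi>"
    proof (rule recolours_two_colours[OF _ r _ pq(3)])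
      show "min_degree_le r (V - B) 1" by (rule min_degree_le_subset[OF deg _ V]) auto
      show "dicolours r (V - B) {p, q} \<phi>1" by (rule dicolours_restrict[OF dic1]) (use \<phi>1 in auto)
      show "dicolours r (V - B) {p, q} \<psi>" by (rule dicolours_restrict[OF \<psi>]) (auto simp: B_def)
    qed (use V in auto)
    then have "recolours r V K (2 * card (V - B)) (\<lambda>v. if v \<in> B then \<psi> v else \<phi>1 v)
      (\<lambda>v. if v \<in> B then \<psi> v else \<psi> v)"
    proof (rule recolours_extend)
      fix \<chi> assume "dicolours r (V - B) {p, q} \<chi>"
      then show "dicolours r V K (\<lambda>v. if v \<in> B then \<psi> v else \<chi> v)"
      proof (rule dicolours_override)
        show "acyclic_on r {v \<in> B. \<psi> v = i}" for i
          by (rule acyclic_on_mono[OF acyc(4)[of i]]) (auto simp: B_def)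
      qed (use pq \<psi> in \<open>auto simp: B_def dicolours_def\<close>)
    qed
    then have stage3: "recolours r V K (2 * card (V - B)) \<phi>2 \<psi>" by (simp add: \<phi>2_def[abs_def])
    have "recolours r V K (card X + (card B + 2 * card (V - B))) \<phi> \<psi>"
      by (rule recolours_trans[OF recolours_trans[OF stage3 stage2] stage1])
    moreover have "V - B = {v \<in> V. \<psi> v \<in> {p, q}}" "V - X = {v \<in> V. \<phi> v \<in> {p, q}}"
      by (auto simp: B_def X_def)
    then have "card (V - B) \<le> card (V - X)" using le by simp
    moreover have "card (V - B) + card B = card V" "card (V - X) + card X = card V"
      using V card_Diff_subset[of B V] card_Diff_subset[of X V] card_mono[of V B] card_mono[of V X]
      by (auto simp: B_def X_def finite_subset)
    ultimately show ?thesis by (auto elim!: recolours_mono)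
  qed
  show ?thesis
  proof (cases "card {v \<in> V. \<psi> v \<in> {p, q}} \<le> card {v \<in> V. \<phi> v \<in> {p, q}}")
    case True
    then show ?thesis by (rule directed[OF \<phi> \<psi>])
  next
    case False
    then show ?thesis by (intro recolours_sym[OF directed[OF \<psi> \<phi>]]) simp
  qed
qed

text \<open>
  All intermediate classes are subsets of \<open>J\<close> or of classes of \<open>\<phi>\<close>.
\<close>

lemma recolours_to_class:
  assumes V: "finite V" and \<phi>: "dicolours r V K \<phi>" and c: "c \<in> K"
    and J: "J \<subseteq> V" "acyclic_on r J" "{v \<in> V. \<phi> v = c} \<subseteq> J"
  shows "recolours r V K (card J) \<phi> (\<lambda>v. if v \<in> J then c else \<phi> v)"
proof (rule recolours_mono[OF recolours_mix[OF V \<phi>]])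
  fix \<chi> assume \<chi>: "\<And>v. v \<in> V \<Longrightarrow> \<chi> v = \<phi> v \<or> \<chi> v = (if v \<in> J then c else \<phi> v)"
  show "dicolours r V K \<chi>"
    unfolding dicolours_def
  proof (intro conjI ballI allI)
    show "\<chi> v \<in> K" if "v \<in> V" for v
      using \<chi>[OF that] \<phi> c that by (auto simp: dicolours_def split: if_splits)
    show "acyclic_on r {v \<in> V. \<chi> v = i}" for i
    proof (cases "i = c")
      case True
      have "v \<in> J" if "v \<in> V" "\<chi> v = c" for v
        using \<chi>[OF that(1)] that J(3) by (auto split: if_splits)
      then show ?thesis using True by (intro acyclic_on_mono[OF J(2)]) blast
    next
      case False
      have *: "acyclic_on r {v \<in> V. \<phi> v = i}" using \<phi> by (simp add: dicolours_def)
      have "\<phi> v = i" if "v \<in> V" "\<chi> v = i" for v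
        using \<chi>[OF that(1)] that False by (auto split: if_splits)
      then show ?thesis by (intro acyclic_on_mono[OF *]) blast
    qed
  qed
qed (use V J(1) in \<open>auto intro!: card_mono intro: finite_subset\<close>)

lemma dicolours_Diff_class:
  assumes "dicolours r V K \<phi>" "{v \<in> V. \<phi> v = c} \<subseteq> J"
  shows "dicolours r (V - J) (K - {c}) \<phi>"
  by (rule dicolours_restrict[OF assms(1)]) (use assms in \<open>auto simp: dicolours_def\<close>)

lemma recolours_extend_class:
  assumes "recolours r (V - J) (K - {c}) n \<phi> \<psi>" "c \<in> K" "acyclic_on r J"
  shows "recolours r V K n (\<lambda>v. if v \<in> J then c else \<phi> v) (\<lambda>v. if v \<in> J then c else \<psi> v)"
  using assms(1)
proof (rule recolours_extend)
  fix \<chi> assume "dicolours r (V - J) (K - {c}) \<chi>"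
  then show "dicolours r V K (\<lambda>v. if v \<in> J then c else \<chi> v)"
  proof (rule dicolours_override)
    show "acyclic_on r {v \<in> J. c = i}" for i by (rule acyclic_on_mono[OF assms(3)]) auto
  qed (use assms(2) in auto)
qed

text \<open>
  Paint \<open>J\<close> with \<open>c\<close>, recolour the rest without using \<open>c\<close>, and give \<open>J\<close> its final colours.
\<close>

lemma recolours_via_class:
  assumes "finite V" "dicolours r V K \<phi>" "dicolours r V K \<psi>" "c \<in> K"
    "J \<subseteq> V" "acyclic_on r J" "{v \<in> V. \<phi> v = c} \<subseteq> J" "{v \<in> V. \<psi> v = c} \<subseteq> J"
    "recolours r (V - J) (K - {c}) n \<phi> \<psi>"
  shows "recolours r V K (2 * card J + n) \<phi> \<psi>"
proof -
  have "recolours r V K (card J + (n + card J)) \<phi> \<psi>"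
    by (rule recolours_trans[OF recolours_trans[OF recolours_sym recolours_extend_class]])
      (use assms in \<open>auto intro!: recolours_to_class\<close>)
  then show ?thesis by (rule recolours_mono) simp
qed

lemma dicolours_exists:
  assumes "finite V" "asym r" "min_degree_le r V d" "d < card K"
  shows "\<exists>\<phi>. dicolours r V K \<phi>"
  using assms(1,3,4)
proof (induction d arbitrary: V K)
  case 0
  then obtain c where "c \<in> K" by (metis card.empty ex_in_conv less_irrefl)
  have "acyclic_on r V" by (rule acyclic_on_min_degree_0) (use 0 assms in auto)
  then have "dicolours r V K (\<lambda>_. c)"
    using \<open>c \<in> K\<close> by (auto simp: dicolours_def intro: acyclic_on_mono[of r V])
  then show ?case by blast
next
  case (Suc d)
  then obtain c where c: "c \<in> K" by (metis card.empty ex_in_conv less_nat_zero_code)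
  obtain J where J: "J \<subseteq> V" "acyclic_on r J" "\<And>v. v \<in> V - J \<Longrightarrow> \<not> acyclic_on r (insert v J)"
    using maximal_acyclic_extension[of V "{}" r] Suc.prems by auto
  have "min_degree_le r (V - J) d"
    by (rule min_degree_le_Diff_maximal[OF Suc.prems(1) assms(2) Suc.prems(2) J])
  moreover have "d < card (K - {c})" using Suc.prems(3) c by (simp add: card_Diff_singleton)
  ultimately obtain \<chi> where \<chi>: "dicolours r (V - J) (K - {c}) \<chi>"
    using Suc.IH[of "V - J" "K - {c}"] Suc.prems(1) by blast
  have "dicolours r V K (\<lambda>v. if v \<in> J then c else \<chi> v)"
    using recolours_extend_class[OF recolours.refl[OF \<chi>, of \<chi>] c J(2)] recolours_dicol by blast
  then show ?case by blast
qed

text \<open>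
  For \<open>d = 2\<close>, go to a 2-dicolouring, via a maximal acyclic set painted with a third colour \<open>c\<close>; outside this set the
  degree bound is 1. For larger \<open>d\<close>, paint a maximal acyclic set with an arbitrary colour and free a colour in the rest.
\<close>

lemma recolours_free_colour:
  assumes "finite V" "asym r" "min_degree_le r V d" "2 \<le> d" "d < card K" "dicolours r V K \<phi>"
  shows "\<exists>c\<in>K. \<exists>\<psi>. dicolours r V (K - {c}) \<psi> \<and> recolours r V K (2 * card V) \<phi> \<psi>"
  using assms(4,1,3,5,6)
proof (induction d arbitrary: V K \<phi> rule: nat_induct_at_least)
  case base
  have "finite K" using base by (auto intro: card_ge_0_finite)
  obtain L where "L \<subseteq> K" "card L = 3"
    using obtain_subset_with_card_n[of 3 K] base by auto
  then obtain p q c where pqc: "p \<in> K" "q \<in> K" "c \<in> K" "p \<noteq> q" "p \<noteq> c" "q \<noteq> c"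
    by (auto simp: card_3_iff)
  obtain J where J: "{v \<in> V. \<phi> v = c} \<subseteq> J" "J \<subseteq> V" "acyclic_on r J"
    "\<And>v. v \<in> V - J \<Longrightarrow> \<not> acyclic_on r (insert v J)"
    using maximal_acyclic_extension[of V "{v \<in> V. \<phi> v = c}" r] base by (auto simp: dicolours_def)
  obtain \<gamma> where \<gamma>: "two_dicolours r V \<gamma>"
    using two_colourable_min_degree_2 base assms(2) by blast
  define \<psi> where "\<psi> v = (if \<gamma> v then p else q)" for v
  have "acyclic_on r {v \<in> V. \<psi> v = i}" for i
  proof (rule acyclic_on_mono[of r "{v \<in> V. \<gamma> v = (i = p)}"])
    show "acyclic_on r {v \<in> V. \<gamma> v = (i = p)}" using \<gamma> by (simp add: two_dicolours_def)
  qed (use pqc in \<open>auto simp: \<psi>_def split: if_splits\<close>)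
  then have \<psi>: "dicolours r V (K - {c}) \<psi>" using pqc by (auto simp: dicolours_def \<psi>_def)
  have "min_degree_le r (V - J) 1"
    using min_degree_le_Diff_maximal[of V r 1 J] base assms(2) J by (simp add: numeral_2_eq_2)
  then have "recolours r (V - J) (K - {c}) (2 * card (V - J)) \<phi> \<psi>"
    using base assms(2) pqc(3) J(1) \<open>finite K\<close>
    by (intro recolours_min_degree_1 dicolours_Diff_class dicolours_restrict[OF \<psi>])
      (auto simp: card_Diff_singleton \<psi>_def pqc)
  then have "recolours r V K (2 * card J + 2 * card (V - J)) \<phi> \<psi>"
    using base J pqc \<psi> by (intro recolours_via_class) (auto simp: \<psi>_def intro: dicolours_mono[OF \<psi>])
  moreover have "card J + card (V - J) = card V"
    using J(2) base card_Diff_subset[of J V] card_mono[of V J] by (auto simp: finite_subset)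
  then have "2 * card J + 2 * card (V - J) = 2 * card V" by simp
  ultimately show ?case using \<psi> pqc(3) by auto
next
  case (Suc d)
  have "finite K" using Suc.prems by (auto intro: card_ge_0_finite)
  obtain c where c: "c \<in> K" using Suc.prems by (metis card.empty ex_in_conv less_nat_zero_code)
  obtain J where J: "{v \<in> V. \<phi> v = c} \<subseteq> J" "J \<subseteq> V" "acyclic_on r J"
    "\<And>v. v \<in> V - J \<Longrightarrow> \<not> acyclic_on r (insert v J)"
    using maximal_acyclic_extension[of V "{v \<in> V. \<phi> v = c}" r] Suc.prems by (auto simp: dicolours_def)
  have "min_degree_le r (V - J) d"
    by (rule min_degree_le_Diff_maximal[OF Suc.prems(1) assms(2) Suc.prems(2) J(2-4)])
  moreover have "dicolours r (V - J) (K - {c}) \<phi>"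
    by (rule dicolours_Diff_class[OF Suc.prems(4) J(1)])
  moreover have card: "d < card (K - {c})" using Suc.prems(3) c by (simp add: card_Diff_singleton)
  ultimately obtain c' \<psi> where c': "c' \<in> K - {c}" "dicolours r (V - J) (K - {c} - {c'}) \<psi>"
    "recolours r (V - J) (K - {c}) (2 * card (V - J)) \<phi> \<psi>"
    using Suc.IH[of "V - J" "K - {c}" \<phi>] Suc.prems(1) card by blast
  let ?\<psi> = "\<lambda>v. if v \<in> J then c else \<psi> v"
  have "recolours r (V - J) (K - {c'} - {c}) 0 \<psi> \<psi>"
    using c'(2) by (intro recolours.refl) (auto simp: Diff_insert2[symmetric] insert_commute)
  then have "dicolours r V (K - {c'}) ?\<psi>"
    using recolours_extend_class[of r V J "K - {c'}" c 0 \<psi> \<psi>] recolours_dicol c c'(1) J(3) by blast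
  moreover have "recolours r V K (card J + 2 * card (V - J)) \<phi> ?\<psi>"
    using recolours_trans[OF recolours_extend_class[OF c'(3) c J(3)] recolours_to_class[OF Suc.prems(1,4) c J(2,3,1)]] .
  then have "recolours r V K (2 * card V) \<phi> ?\<psi>"
    by (rule recolours_mono)
      (use J(2) Suc.prems(1) card_Diff_subset[of J V] card_mono[of V J] in \<open>auto simp: finite_subset\<close>)
  ultimately show ?case using c'(1) by blast
qed

lemma recolours_bound:
  assumes "finite V" "asym r" "min_degree_le r V d" "1 \<le> d" "d < card K"
    "dicolours r V K \<phi>" "dicolours r V K \<psi>"
  shows "recolours r V K (2 * d * card V) \<phi> \<psi>"
  using assms(4,1,3,5-7)
proof (induction d arbitrary: V K \<phi> \<psi> rule: nat_induct_at_least)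
  case base
  then show ?case using recolours_min_degree_1[of V r K \<phi> \<psi>] assms(2) by simp
next
  case (Suc d)
  have "finite K" using Suc.prems by (auto intro: card_ge_0_finite)
  obtain c \<chi> where c: "c \<in> K" and \<chi>: "dicolours r V (K - {c}) \<chi>" "recolours r V K (2 * card V) \<phi> \<chi>"
    using recolours_free_colour[of V r "Suc d" K \<phi>] Suc assms(2) by auto
  obtain J where J: "{v \<in> V. \<psi> v = c} \<subseteq> J" "J \<subseteq> V" "acyclic_on r J"
    "\<And>v. v \<in> V - J \<Longrightarrow> \<not> acyclic_on r (insert v J)"
    using maximal_acyclic_extension[of V "{v \<in> V. \<psi> v = c}" r] Suc.prems by (auto simp: dicolours_def)
  have \<chi>_c: "{v \<in> V. \<chi> v = c} \<subseteq> J" using \<chi>(1) by (auto simp: dicolours_def)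
  have "min_degree_le r (V - J) d"
    by (rule min_degree_le_Diff_maximal[OF Suc.prems(1) assms(2) Suc.prems(2) J(2-4)])
  then have "recolours r (V - J) (K - {c}) (2 * d * card (V - J)) \<chi> \<psi>"
    using Suc.prems c J(1) dicolours_mono[OF \<chi>(1), of K] \<chi>_c
    by (intro Suc.IH dicolours_Diff_class[of r V K]) (auto simp: card_Diff_singleton)
  then have "recolours r V K (2 * card J + 2 * d * card (V - J)) \<chi> \<psi>"
    using Suc.prems c J dicolours_mono[OF \<chi>(1), of K] \<chi>_c by (intro recolours_via_class) auto
  from recolours_trans[OF this \<chi>(2)]
  have "recolours r V K (2 * card V + (2 * card J + 2 * d * card (V - J))) \<phi> \<psi>" .
  moreover have cV: "card V = card J + card (V - J)"
    using J(2) Suc.prems(1) card_Diff_subset[of J V] card_mono[of V J] by (auto simp: finite_subset)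
  have "2 * card J \<le> 2 * d * card J" using Suc.hyps by simp
  then have "2 * card V + (2 * card J + 2 * d * card (V - J)) \<le> 2 * Suc d * card V"
    unfolding cV by (simp add: algebra_simps)
  ultimately show ?case by (rule recolours_mono)
qed

section \<open>From relations to digraphs\<close>

lemma (in wf_digraph) ex_cycle_iff: "(\<exists>p. cycle p) \<longleftrightarrow> \<not> acyclic (arcs_ends G)"
proof
  assume "\<exists>p. cycle p"
  then obtain u p where "awalk u p u" "p \<noteq> []" by (auto simp: cycle_def)
  then have "u \<rightarrow>\<^sup>+ u" by (rule reachable1_awalkI)
  then show "\<not> acyclic (arcs_ends G)" by (auto simp: acyclic_def)
next
  assume "\<not> acyclic (arcs_ends G)"
  then obtain u where "u \<rightarrow>\<^sup>+ u" by (auto simp: acyclic_def)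
  then obtain p where "awalk u p u" "p \<noteq> []" by (auto simp: reachable1_awalk)
  then have "closed_w p" by (auto simp: closed_w_def)
  then show "\<exists>p. cycle p" by (rule closed_w_imp_cycle)
qed

lemma (in wf_digraph) ex_cycle_induce_subgraph_iff:
  assumes "S \<subseteq> verts G"
  shows "(\<exists>p. pre_digraph.cycle (G \<restriction> S) p) \<longleftrightarrow> \<not> acyclic_on (arcs_ends G) S"
proof -
  interpret H: wf_digraph "G \<restriction> S" by (rule wellformed_induce_subgraph)
  have "arcs_ends (G \<restriction> S) = Restr (arcs_ends G) S"
    by (auto simp: arcs_ends_conv)
  then show ?thesis using H.ex_cycle_iff by (simp add: acyclic_on_def)
qed

lemma (in wf_digraph) is_dicolouring_iff:
  "is_dicolouring G k c \<longleftrightarrow>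
    c \<in> extensional (verts G) \<and> dicolours (arcs_ends G) (verts G) {1..k} c"
proof -
  have "(\<exists>p. pre_digraph.cycle (G \<restriction> {v \<in> verts G. c v = i}) p) \<longleftrightarrow>
      \<not> acyclic_on (arcs_ends G) {v \<in> verts G. c v = i}" for i
    by (rule ex_cycle_induce_subgraph_iff) auto
  moreover have "acyclic_on (arcs_ends G) {v \<in> verts G. c v = i}"
    if "\<forall>v\<in>verts G. c v \<in> {1..k}" "i \<notin> {1..k}" for i
  proof -
    have empty: "{v \<in> verts G. c v = i} = {}" using that by auto
    show ?thesis unfolding empty by (rule acyclic_on_empty)
  qed
  ultimately show ?thesis
    unfolding is_dicolouring_def dicolours_def PiE_def Pi_def by blast
qed

lemma (in digraph) min_degree_le_Delta_min:
  "min_degree_le (arcs_ends G) (verts G) (Delta_min G)"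
  unfolding min_degree_le_def
proof
  fix v assume v: "v \<in> verts G"
  have "in_nbrs (arcs_ends G) (verts G) v = tail G ` in_arcs G v"
    by (auto simp: in_nbrs_def arcs_ends_conv image_iff)
  moreover have "out_nbrs (arcs_ends G) (verts G) v = head G ` out_arcs G v"
    by (auto simp: out_nbrs_def arcs_ends_conv image_iff)
  ultimately have "card (in_nbrs (arcs_ends G) (verts G) v) \<le> in_degree G v"
    "card (out_nbrs (arcs_ends G) (verts G) v) \<le> out_degree G v"
    unfolding in_degree_def out_degree_def by (auto intro!: card_image_le)
  moreover have "min (out_degree G v) (in_degree G v) \<le> Delta_min G"
    unfolding Delta_min_def using v by (intro Max_ge) auto
  ultimately show "card (in_nbrs (arcs_ends G) (verts G) v) \<le> Delta_min G \<or>
      card (out_nbrs (arcs_ends G) (verts G) v) \<le> Delta_min G"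
    by linarith
qed

text \<open>
  Steps that change no value on the vertices of \<open>G\<close> do not correspond to arcs and are dropped, so the walk may be shorter than
  the sequence. Restricting the colourings to the vertices makes them extensional.
\<close>

lemma (in fin_digraph) awalk_of_recolours:
  assumes "recolours (arcs_ends G) (verts G) {1..k} n \<phi> \<chi>" "\<phi> \<in> extensional (verts G)"
  shows "\<exists>p. pre_digraph.awalk (dicolouring_graph G k) \<phi> p (restrict \<chi> (verts G)) \<and> length p \<le> n"
proof -
  interpret D: graph "dicolouring_graph G k" by (rule graph_dicolouring_graph)
  have vert: "restrict \<psi> (verts G) \<in> verts (dicolouring_graph G k)"
    if "dicolours (arcs_ends G) (verts G) {1..k} \<psi>" for \<psi>
    using that dicolours_cong[of "verts G" "restrict \<psi> (verts G)" \<psi>]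
    by (simp add: dicolouring_graph_def is_dicolouring_iff)
  show ?thesis
    using assms
  proof (induction rule: recolours.induct)
    case (refl \<phi> \<psi> n)
    have "restrict \<psi> (verts G) = \<phi>"
      using refl by (auto simp: restrict_def extensional_def fun_eq_iff)
    moreover have "\<phi> \<in> verts (dicolouring_graph G k)"
      using vert[OF refl.hyps(1)] extensional_restrict[OF refl.prems] by simp
    ultimately show ?case by (intro exI[of _ "[]"]) (simp add: D.awalk_Nil_iff)
  next
    case (step n \<phi> \<psi> \<chi> v)
    let ?R = "\<lambda>\<psi>. restrict \<psi> (verts G)"
    obtain p where p: "D.awalk \<phi> p (?R \<psi>)" "length p \<le> n" using step.IH step.prems by blast
    show ?case
    proof (cases "?R \<psi> = ?R \<chi>")
      case True
      then have "D.awalk \<phi> p (?R \<chi>)" "length p \<le> Suc n" using p by simp_all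
      then show ?thesis by blast
    next
      case False
      obtain x where "?R \<psi> x \<noteq> ?R \<chi> x" using False by blast
      then have x: "x \<in> verts G" "\<psi> x \<noteq> \<chi> x" by (auto simp: restrict_def split: if_splits)
      then have "x = v" using step.hyps(3) by blast
      then have "\<exists>!u. u \<in> verts G \<and> ?R \<psi> u \<noteq> ?R \<chi> u"
        using x step.hyps(3) by (intro ex1I[of _ v]) auto
      then have arc: "(?R \<psi>, ?R \<chi>) \<in> arcs (dicolouring_graph G k)"
        using vert[OF step.hyps(2)] vert[of \<psi>] recolours_dicol[OF step.hyps(1)]
        by (simp add: dicolouring_graph_def)
      from D.arc_implies_awalk[OF this]
      have "D.awalk (?R \<psi>) [(?R \<psi>, ?R \<chi>)] (?R \<chi>)"
        by (simp add: dicolouring_graph_def)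
      from D.awalk_appendI[OF p(1) this]
      have "D.awalk \<phi> (p @ [(?R \<psi>, ?R \<chi>)]) (?R \<chi>)" .
      moreover have "length (p @ [(?R \<psi>, ?R \<chi>)]) \<le> Suc n" using p(2) by simp
      ultimately show ?thesis by blast
    qed
  qed
qed

lemma (in wf_digraph) awalk_cost_unit: "awalk_cost (\<lambda>_. 1) p = real (length p)"
  by (induction p) auto

theorem corollary10:
  fixes G :: "('a, 'b) pre_digraph" and n \<Delta> k :: nat
  assumes "oriented_graph G"
    and "card (verts G) = n"
    and "Delta_min G = \<Delta>" and "\<Delta> \<ge> 1"
    and "k \<ge> \<Delta> + 1"
  shows "Digraph_Component.connected (dicolouring_graph G k) \<and>
    graph_diameter (dicolouring_graph G k) \<le> ereal (real (2 * \<Delta> * n))"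
proof -
  interpret oriented_graph G by fact
  let ?D = "dicolouring_graph G k" and ?r = "arcs_ends G"
  interpret D: graph ?D by (rule graph_dicolouring_graph)
  have asym: "asym ?r" using no_opposite_arcs by (auto intro!: asymI)
  have deg: "min_degree_le ?r (verts G) \<Delta>" using min_degree_le_Delta_min assms(3) by simp
  have k: "\<Delta> < card {1..k}" using assms(5) by simp
  have walk: "\<exists>p. D.awalk \<phi> p \<psi> \<and> length p \<le> 2 * \<Delta> * n"
    if "\<phi> \<in> verts ?D" "\<psi> \<in> verts ?D" for \<phi> \<psi>
  proof -
    have dic: "dicolours ?r (verts G) {1..k} \<phi>" "dicolours ?r (verts G) {1..k} \<psi>"
      and ext: "\<phi> \<in> extensional (verts G)" "\<psi> \<in> extensional (verts G)"
      using that by (auto simp: dicolouring_graph_def is_dicolouring_iff)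
    from recolours_bound[OF _ asym deg assms(4) k dic]
    have "recolours ?r (verts G) {1..k} (2 * \<Delta> * n) \<phi> \<psi>" using assms(2) by simp
    from awalk_of_recolours[OF this ext(1)] show ?thesis
      by (simp add: extensional_restrict[OF ext(2)])
  qed
  have "verts ?D \<noteq> {}"
  proof -
    obtain \<phi> where "dicolours ?r (verts G) {1..k} \<phi>"
      using dicolours_exists[OF _ asym deg k] by auto
    then have "restrict \<phi> (verts G) \<in> verts ?D"
      using dicolours_cong[of "verts G" "restrict \<phi> (verts G)" \<phi>]
      by (simp add: dicolouring_graph_def is_dicolouring_iff)
    then show ?thesis by blast
  qed
  then have "strongly_connected ?D"
    using walk by (intro strongly_connectedI) (auto dest: D.reachable_awalkI)
  then have "Digraph_Component.connected ?D"
    using D.reachable_mk_symmetricI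
    by (auto simp: Digraph_Component.connected_def strongly_connected_def)
  moreover have "graph_diameter ?D \<le> ereal (real (2 * \<Delta> * n))"
    unfolding graph_diameter_def
  proof (intro SUP_least)
    fix \<phi> \<psi> assume "\<phi> \<in> verts ?D" "\<psi> \<in> verts ?D"
    then obtain p where p: "D.awalk \<phi> p \<psi>" "length p \<le> 2 * \<Delta> * n" using walk by blast
    have "D.\<mu> (\<lambda>_. 1) \<phi> \<psi> \<le> ereal (D.awalk_cost (\<lambda>_. 1) p)"
      by (rule D.min_cost_le_walk_cost[OF p(1)])
    also have "\<dots> \<le> ereal (real (2 * \<Delta> * n))"
      using p(2) by (simp only: D.awalk_cost_unit ereal_less_eq(3) of_nat_le_iff)
    finally show "D.\<mu> (\<lambda>_. 1) \<phi> \<psi> \<le> ereal (real (2 * \<Delta> * n))" .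
  qed
  ultimately show ?thesis ..
qed

end
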